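(* Let $m\ge 1$ be odd, $d\ge 1$, let $R=\sum_{i=0}^d a_ix^{2^i}\in\mathbf{F}_{2^m}[x]$ with $a_d\neq 0$, and set $f(x)=xR(x)$. Let $\widetilde R=\sum_{i=0}^d\left(a_i^{2^d}x^{2^{d+i}}+a_i^{2^{d-i}}x^{2^{d-i}}\right)$, let $\mathbf{F}_{2^{mN}}$ be the splitting field of $\widetilde R$ over $\mathbf{F}_{2^m}$, and write $N=2^aN'$ with $N'$ odd. Then for any odd integer $n\ge1$, $$\varepsilon_n(f)=\chi\bigl(n\gcd(n,N')\bigr)\,\varepsilon_{\gcd(n,N')}(f).$$
   Context: $\chi$ is the Dirichlet character modulo $8$ with $\chi(1)=\chi(7)=1$ and $\chi(3)=\chi(5)=-1$. For a quadratic form $q$ on a $k$-dimensional $\mathbf{F}_2$-vector space $V$, with polarisation $b(x,y)=q(x+y)+q(x)+q(y)$ whose radical has dimension $c$ (set $r=k-c$), the invariant $\varepsilon(q)\in\{0,1,-1\}$ is defined as follows: $\varepsilon(q)=0$ if $q$ is not identically zero on the radical of $b$ (equivalently $q$ is isometric to $x_1x_2+\cdots+x_{r-1}x_r+x_{r+1}^2$); $\varepsilon(q)=1$ if $q$ is isometric to $x_1x_2+\cdots+x_{r-1}x_r$; $\varepsilon(q)=-1$ if $q$ is isometric to $x_1^2+x_1x_2+x_2^2+x_3x_4+\cdots+x_{r-1}x_r$. One has $\sum_{x\in V}(-1)^{q(x)}=\varepsilon(q)2^{(k+c)/2}$. For $n\ge1$, $q_n=\mathrm{Tr}_{\mathbf{F}_{2^{mn}}/\mathbf{F}_2}\circ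 f$ is a quadratic form on the $\mathbf{F}_2$-vector space $\mathbf{F}_{2^{mn}}$, and $\varepsilon_n(f):=\varepsilon(q_n)$. *)

theory Defs
  imports
    "HOL-Computational_Algebra.Computational_Algebra"
    "HOL-Library.Z2"
    "HOL-Library.Function_Algebras"
begin

section \<open>Quadratic forms over the field with two elements\<close>

text \<open>
  The field with two elements is the type \<^typ>\<open>bit\<close>. In an abelian group in which
  \<open>x + x = 0\<close> for all \<open>x\<close>, the following is the only possible scalar multiplication; it is
  only used to obtain the dimension from the library's vector spaces. In particular, a
  map between such groups is linear as soon as it is additive.
\<close>

definition scale2 :: "bit \<Rightarrow> 'v::ab_group_add \<Rightarrow> 'v" where
  "scale2 c x = (if c = 0 then 0 else x)"

lemma vector_space_scale2:
  assumes "\<And>x :: 'v::ab_group_add. x + x = 0"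
  shows "vector_space (scale2 :: bit \<Rightarrow> 'v \<Rightarrow> 'v)"
  by standard (auto simp: scale2_def assms)

definition dim2 :: "'v::ab_group_add set \<Rightarrow> nat" where
  "dim2 V = vector_space.dim scale2 V"

definition polarisation :: "('v::ab_group_add \<Rightarrow> bit) \<Rightarrow> 'v \<Rightarrow> 'v \<Rightarrow> bit" where
  "polarisation q x y = q (x + y) + q x + q y"

definition radical :: "'v::ab_group_add set \<Rightarrow> ('v \<Rightarrow> bit) \<Rightarrow> 'v set" where
  "radical V q = {x \<in> V. \<forall>y\<in>V. polarisation q x y = 0}"

definition qf_isometric ::
  "'v::ab_group_add set \<Rightarrow> ('v \<Rightarrow> bit) \<Rightarrow> 'w::ab_group_add set \<Rightarrow> ('w \<Rightarrow> bit) \<Rightarrow> bool" where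
  "qf_isometric V q W q' \<longleftrightarrow>
     (\<exists>\<phi>. bij_betw \<phi> V W \<and> (\<forall>x\<in>V. \<forall>y\<in>V. \<phi> (x + y) = \<phi> x + \<phi> y) \<and> (\<forall>x\<in>V. q' (\<phi> x) = q x))"

text \<open>
  The coordinate space of dimension \<open>k\<close>. The coordinates \<open>x\<^sub>1, \<dots>, x\<^sub>k\<close> of the usual notation
  are \<open>x 0, \<dots>, x (k - 1)\<close> here, and addition is pointwise.
\<close>

definition F2_space :: "nat \<Rightarrow> (nat \<Rightarrow> bit) set" where
  "F2_space k = {x. \<forall>i\<ge>k. x i = 0}"

text \<open>The forms \<open>x\<^sub>1x\<^sub>2 + \<dots> + x\<^sub>r\<^sub>-\<^sub>1x\<^sub>r\<close> and \<open>x\<^sub>1\<^sup>2 + x\<^sub>1x\<^sub>2 + x\<^sub>2\<^sup>2 + x\<^sub>3x\<^sub>4 + \<dots> + x\<^sub>r\<^sub>-\<^sub>1x\<^sub>r\<close> for even \<open>r\<close>.\<close>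

definition hyperbolic_form :: "nat \<Rightarrow> (nat \<Rightarrow> bit) \<Rightarrow> bit" where
  "hyperbolic_form r x = (\<Sum>i<r div 2. x (2 * i) * x (2 * i + 1))"

definition elliptic_form :: "nat \<Rightarrow> (nat \<Rightarrow> bit) \<Rightarrow> bit" where
  "elliptic_form r x =
     (x 0)^2 + x 0 * x 1 + (x 1)^2 + (\<Sum>i=1..<r div 2. x (2 * i) * x (2 * i + 1))"

text \<open>
  For a quadratic form on a finite-dimensional space exactly one of the three conditions
  holds, so the final \<^const>\<open>undefined\<close> is never reached. The condition \<open>2 \<le> r\<close> says that the
  variables \<open>x\<^sub>1, x\<^sub>2\<close> of the elliptic form are among \<open>x\<^sub>1, \<dots>, x\<^sub>r\<close>.
\<close>

definition qf_eps :: "'v::ab_group_add set \<Rightarrow> ('v \<Rightarrow> bit) \<Rightarrow> int" where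
  "qf_eps V q =
     (let k = dim2 V; c = dim2 (radical V q); r = k - c in
      if \<exists>x\<in>radical V q. q x \<noteq> 0 then 0
      else if qf_isometric V q (F2_space k) (hyperbolic_form r) then 1
      else if 2 \<le> r \<and> qf_isometric V q (F2_space k) (elliptic_form r) then -1
      else undefined)"

section \<open>Finite fields of characteristic two\<close>

text \<open>
  All finite fields of characteristic two are taken inside a fixed algebraically closed
  field \<open>'k\<close> of characteristic two. For \<open>n > 0\<close>, the set \<open>GF2 n\<close> of roots of
  \<open>X\<^bsup>2^n\<^esup> - X\<close> is the only subfield with \<open>2^n\<close> elements; see \<open>card_GF2\<close> and
  \<open>subfield_eq_GF2\<close> below.
\<close>

definition GF2 :: "nat \<Rightarrow> 'k::field set" where
  "GF2 n = {x. x ^ (2 ^ n) = x}"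

definition is_subfield :: "'k::field set \<Rightarrow> bool" where
  "is_subfield L \<longleftrightarrow> 0 \<in> L \<and> 1 \<in> L \<and>
     (\<forall>x\<in>L. \<forall>y\<in>L. x + y \<in> L \<and> x * y \<in> L) \<and> (\<forall>x\<in>L. - x \<in> L \<and> inverse x \<in> L)"

text \<open>As \<open>'k\<close> is algebraically closed, all roots of \<open>p\<close> are available in \<open>'k\<close>.\<close>

definition splitting_field :: "'k::alg_closed_field set \<Rightarrow> 'k poly \<Rightarrow> 'k set" where
  "splitting_field F p = \<Inter> {L. is_subfield L \<and> F \<subseteq> L \<and> {x. poly p x = 0} \<subseteq> L}"

text \<open>
  The absolute trace of the field with \<open>2^n\<close> elements: the sum of the conjugates, which lies
  in the prime field \<open>{0, 1}\<close> of \<open>'k\<close> and is then read as an element of \<^typ>\<open>bit\<close>.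
\<close>

definition conj_sum :: "nat \<Rightarrow> 'k::field \<Rightarrow> 'k" where
  "conj_sum n x = (\<Sum>i<n. x ^ (2 ^ i))"

definition abs_trace :: "nat \<Rightarrow> 'k::field \<Rightarrow> bit" where
  "abs_trace n x = (THE b. of_bit b = conj_sum n x)"

text \<open>The invariant \<open>\<epsilon>\<^sub>n(f)\<close>, for \<open>f\<close> with coefficients in the field with \<open>2^m\<close> elements.\<close>

definition eps_ext :: "nat \<Rightarrow> nat \<Rightarrow> 'k::field poly \<Rightarrow> int" where
  "eps_ext m n f = qf_eps (GF2 (m * n)) (\<lambda>x. abs_trace (m * n) (poly f x))"

definition chi8 :: "nat \<Rightarrow> int" where
  "chi8 n = (if n mod 8 \<in> {1, 7} then 1 else if n mod 8 \<in> {3, 5} then -1 else 0)"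

subsection \<open>Consistency of the encoding\<close>

lemma char2_add_self:
  assumes "CHAR('k::field) = 2"
  shows "(x::'k) + x = 0"
proof -
  have "of_nat CHAR('k) = (0::'k)" by (rule of_nat_CHAR)
  then have "(2::'k) = 0" by (simp add: assms)
  then show ?thesis by (metis mult_2 mult_zero_left)
qed

lemma char2_add_power:
  assumes "CHAR('k::field) = 2"
  shows "((x::'k) + y) ^ (2 ^ n) = x ^ (2 ^ n) + y ^ (2 ^ n)"
proof (induction n)
  case (Suc n)
  have sq: "(u + v)^2 = u^2 + v^2" for u v :: 'k
  proof -
    have "(u + v)^2 = u^2 + v^2 + (u * v + u * v)" by (simp add: power2_eq_square algebra_simps)
    then show ?thesis by (simp add: char2_add_self[OF assms])
  qed
  have "(x + y) ^ (2 ^ Suc n) = ((x + y) ^ (2 ^ n))^2"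
    by (simp only: power_Suc2 power_mult)
  also have "\<dots> = (x ^ (2 ^ n))^2 + (y ^ (2 ^ n))^2" by (simp only: Suc sq)
  finally show ?case by (simp only: power_Suc2 power_mult)
qed simp

lemma is_subfield_GF2:
  assumes "CHAR('k::field) = 2"
  shows "is_subfield (GF2 n :: 'k set)"
proof -
  have neg: "- x = x" for x :: 'k
    using char2_add_self[OF assms] by (metis minus_unique)
  show ?thesis
    unfolding is_subfield_def GF2_def
    by (auto simp: char2_add_power[OF assms] power_mult_distrib neg power_inverse)
qed

lemma card_GF2:
  assumes "CHAR('k::alg_closed_field) = 2" and n: "n > 0"
  shows "card (GF2 n :: 'k set) = 2 ^ n"
proof -
  let ?q = "2 ^ n :: nat"
  define p :: "'k poly" where "p = monom 1 ?q - monom 1 1"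
  have q: "?q > 1" using n by (intro one_less_power) simp_all
  have c: "coeff p ?q = 1" using q by (simp add: p_def)
  have deg: "degree p = ?q"
  proof (rule antisym)
    show "degree p \<le> ?q"
      unfolding p_def using q by (intro degree_diff_le) (simp_all add: degree_monom_eq)
    show "?q \<le> degree p" using c by (intro le_degree) simp
  qed
  have p0: "p \<noteq> 0" using c by auto
  have "of_nat ?q = (0::'k)" using assms n by (subst of_nat_eq_0_iff_char_dvd) simp
  then have pd: "pderiv p = - 1" using n
    unfolding p_def by (simp add: pderiv_diff pderiv_monom monom_0 one_pCons zero_power)
  have roots: "{x. poly p x = 0} = GF2 n"
    by (auto simp: p_def GF2_def poly_monom)
  obtain A where A: "size A = degree p" "p = smult (lead_coeff p) (\<Prod>x\<in>#A. [:-x, 1:])"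
    using alg_closed_imp_factorization[OF p0] by blast
  have rootsA: "set_mset A = {x. poly p x = 0}"
    using p0 by (subst A(2)) (auto simp: poly_prod_mset)
  have "count A x \<le> 1" for x
  proof (rule ccontr)
    assume "\<not> count A x \<le> 1"
    then have "{#x, x#} \<subseteq># A" by (simp add: subseteq_mset_def)
    then obtain B where "A = {#x, x#} + B" by (metis subset_mset.le_iff_add)
    then have "p = smult (lead_coeff p) ([:-x, 1:] * ([:-x, 1:] * (\<Prod>x\<in>#B. [:-x, 1:])))"
      using A(2) by (simp add: mult.assoc)
    also have "\<dots> = [:-x, 1:] * ([:-x, 1:] * smult (lead_coeff p) (\<Prod>x\<in>#B. [:-x, 1:]))"
      by simp
    finally obtain r where "p = [:-x, 1:] * ([:-x, 1:] * r)" by blast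
    then have "poly (pderiv p) x = 0" by (simp only: pderiv_mult) simp
    then show False by (simp add: pd)
  qed
  then have "A = mset_set (set_mset A)"
    by (intro multiset_eqI) (metis One_nat_def count_eq_zero_iff count_greater_eq_one_iff
        count_mset_set(1,3) finite_set_mset le_antisym)
  then have "card (set_mset A) = size A" by (metis size_mset_set)
  then show ?thesis using A(1) rootsA roots deg by simp
qed

lemma subfield_eq_GF2:
  assumes "CHAR('k::alg_closed_field) = 2" and n: "n > 0"
    and L: "is_subfield (L :: 'k set)" "card L = 2 ^ n"
  shows "L = GF2 n"
proof -
  have fin: "finite L" using L(2) by (metis card.infinite power_not_zero zero_neq_numeral)
  have sub: "L \<subseteq> GF2 n"
  proof
    fix x assume x: "x \<in> L"
    show "x \<in> GF2 n"
    proof (cases "x = 0")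
      case False
      let ?S = "L - {0}"
      have inj: "inj_on ((*) x) ?S" using False by (auto simp: inj_on_def)
      have "(*) x ` ?S \<subseteq> ?S" using False x L(1) by (auto simp: is_subfield_def)
      then have im: "(*) x ` ?S = ?S" using inj fin by (intro endo_inj_surj) auto
      have "prod id ?S = (\<Prod>y\<in>?S. x * y)"
        using prod.reindex[OF inj, of id] im by (simp add: o_def)
      also have "\<dots> = x ^ card ?S * prod id ?S" by (simp add: prod.distrib)
      finally have "x ^ card ?S = 1" using fin by simp
      moreover have "card L = Suc (card ?S)"
        using L(1) fin by (intro card.remove) (auto simp: is_subfield_def)
      ultimately have "x ^ card L = x" by simp
      then show ?thesis by (simp add: GF2_def L(2))
    qed (simp add: GF2_def)
  qed
  have "finite (GF2 n :: 'k set)" 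
    using card_GF2[OF assms(1) n] by (metis card.infinite power_not_zero zero_neq_numeral)
  then show ?thesis using sub L(2) card_GF2[OF assms(1) n] by (intro card_subset_eq) auto
qed

lemma of_bit_abs_trace:
  assumes "CHAR('k::field) = 2" and x: "(x::'k) \<in> GF2 n"
  shows "of_bit (abs_trace n x) = conj_sum n x"
proof -
  have sq: "(u + v)^2 = u^2 + v^2" for u v :: 'k
    using char2_add_power[OF assms(1), of u v 1] by simp
  have "(conj_sum n x)^2 = (\<Sum>i<n. x ^ (2 ^ Suc i))"
    unfolding conj_sum_def
    by (induction n) (simp_all only: sum.lessThan_Suc sq power_Suc2 power_mult, simp)
  also have "\<dots> = conj_sum n x"
  proof -
    have "x + (\<Sum>i<n. x ^ (2 ^ Suc i)) = (\<Sum>i<Suc n. x ^ (2 ^ i))"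
      by (simp only: sum.lessThan_Suc_shift) simp
    also have "\<dots> = conj_sum n x + x" using x by (simp add: GF2_def conj_sum_def)
    finally show ?thesis by (simp add: add.commute)
  qed
  finally have "conj_sum n x = 0 \<or> conj_sum n x = 1"
    by (simp add: power2_eq_square)
  then have "\<exists>!b. of_bit b = conj_sum n x"
  proof
    assume "conj_sum n x = 0"
    then show ?thesis by (intro ex1I[of _ 0]) (auto split: if_splits)
  next
    assume "conj_sum n x = 1"
    then show ?thesis by (intro ex1I[of _ 1]) (auto split: if_splits)
  qed
  then show ?thesis unfolding abs_trace_def by (rule theI')
qed

end

theory Submission
  imports "HOL-Number_Theory.Gauss" Defs
begin

text \<open>
  The invariant of a quadratic form \<open>q\<close> on a finite vector space \<open>V\<close> is the sign of the integer
  \<open>S(q) = (\<Sum>x\<in>V. (-1) ^ q x)\<close> (\<open>qf_eps_eq_sgn_exp_sum\<close>). The square of this sum is \<open>0\<close> if \<open>q\<close> does not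
  vanish on the radical of its polarisation, and otherwise it is the number of elements of \<open>V\<close> times
  that of the radical (\<open>exp_sum_square\<close>). So \<open>S(q)\<close> is known up to its sign from the radical alone.
  The sign has to be related to the definition by normal forms, which needs the classification of
  quadratic forms over the field with two elements (\<open>quadratic_form_classification\<close>).
  
  For the form with index \<open>n\<close> the radical consists of the roots of \<open>R~\<close> in the field with \<open>2 ^ (m * n)\<close>
  elements (\<open>radical_form\<close>). All roots lie in the field with \<open>2 ^ (m * N)\<close> elements. So for \<open>n\<close> odd and
  \<open>g = gcd n N'\<close>, the roots that lie in the field of index \<open>n\<close> already lie in the field of index \<open>g\<close>,
  and all indices between \<open>g\<close> and \<open>n\<close> in the order of divisibility have the same radical. On it the
  forms agree, as a trace over an extension of odd degree restricts to the trace of the subfield.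
  
  It suffices to pass from an index \<open>l\<close> to \<open>l * p\<close> for one prime \<open>p\<close> at a time
  (\<open>sgn_exp_sum_form_mult_prime\<close>). The Galois group of the extension has order \<open>p\<close> and preserves the
  form, so the orbits outside the smaller field contribute a multiple of \<open>p\<close> to the sum, and the two
  sums \<open>S\<close> and \<open>S'\<close> are congruent modulo \<open>p\<close> (\<open>exp_sum_form_cong\<close>). Up to sign, \<open>S'\<close> is \<open>S\<close> times
  \<open>2 ^ (m * l * ((p - 1) div 2))\<close>. As \<open>m * l\<close> is odd, this power is congruent to \<open>chi8 p\<close> by the second
  supplement to quadratic reciprocity (\<open>two_power_cong_chi8\<close>). Hence the invariant is multiplied by
  \<open>chi8 p\<close>. Altogether it is multiplied by \<open>chi8 (n div g)\<close>, which equals \<open>chi8 (n * g)\<close> since \<open>g\<close> is odd.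
\<close>

section \<open>Exponential sums of quadratic forms\<close>

(* The default simp rules turn sums and products of bits into bitwise operations, where the
   field laws no longer apply. *)
declare add_bit_eq_xor [simp del] mult_bit_eq_and [simp del]

lemma bit_add_self [simp]: "(a::bit) + a = 0"
  by (cases a) simp_all

lemma UNIV_bit: "(UNIV :: bit set) = {0, 1}"
  by (auto intro: bit.exhaust)

definition bit_sign :: "bit \<Rightarrow> int" where
  "bit_sign b = (if b = 0 then 1 else -1)"

lemma bit_sign_0 [simp]: "bit_sign 0 = 1" and bit_sign_1 [simp]: "bit_sign 1 = -1"
  by (simp_all add: bit_sign_def)

lemma bit_sign_add: "bit_sign (a + b) = bit_sign a * bit_sign b"
  by (cases a; cases b) simp_all

definition exp_sum :: "'v set \<Rightarrow> ('v \<Rightarrow> bit) \<Rightarrow> int" where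
  "exp_sum V q = (\<Sum>x\<in>V. bit_sign (q x))"

text \<open>
  A finite \<open>F\<^sub>2\<close>-vector space inside an ambient group. The condition \<open>x + x = 0\<close> is imposed on the
  whole group because \<^const>\<open>scale2\<close>, through which \<^const>\<open>dim2\<close> is defined, makes a vector
  space of the whole type.
\<close>

locale F2_subspace =
  fixes V :: "'v::ab_group_add set"
  assumes add_self: "\<And>x :: 'v. x + x = 0"
    and finite_V: "finite V"
    and zero_mem: "0 \<in> V"
    and add_mem: "\<And>x y. x \<in> V \<Longrightarrow> y \<in> V \<Longrightarrow> x + y \<in> V"
begin

lemma add_add_self [simp]: "x + (x + y) = (y :: 'v)"
  using add_self[of x] by (simp flip: add.assoc)

lemma bij_betw_translation: "u \<in> V \<Longrightarrow> bij_betw ((+) u) V V"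
  by (rule bij_betw_byWitness[where f' = "(+) u"]) (auto intro: add_mem)

text \<open>
  Orthogonality of characters: if \<open>l u = 1\<close> then translation by \<open>u\<close> permutes \<open>V\<close> and changes the
  sign of every term. The lemma serves twice below: for the map \<open>polarisation q y\<close> on \<open>V\<close>, and for
  \<open>q\<close> itself on the radical, where \<open>q\<close> is additive.
\<close>

lemma exp_sum_additive:
  assumes add: "\<And>x y. x \<in> V \<Longrightarrow> y \<in> V \<Longrightarrow> l (x + y) = l x + l y"
  shows "exp_sum V l = (if \<forall>x\<in>V. l x = 0 then int (card V) else 0)"
proof (cases "\<forall>x\<in>V. l x = 0")
  case True
  then show ?thesis by (simp add: exp_sum_def)
next
  case False
  then obtain u where u: "u \<in> V" "l u = 1" by auto
  have "exp_sum V l = (\<Sum>x\<in>V. bit_sign (l (u + x)))"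
    unfolding exp_sum_def
    by (rule sum.reindex_bij_betw[OF bij_betw_translation[OF u(1)], symmetric])
  also have "\<dots> = - exp_sum V l"
    unfolding exp_sum_def sum_negf [symmetric]
    by (rule sum.cong) (simp_all add: add u bit_sign_add)
  finally show ?thesis using False by auto
qed

end

locale F2_quadratic_form = F2_subspace V
  for V :: "'v::ab_group_add set" +
  fixes q :: "'v \<Rightarrow> bit"
  assumes polarisation_add:
    "\<And>x y z. x \<in> V \<Longrightarrow> y \<in> V \<Longrightarrow> z \<in> V \<Longrightarrow>
      polarisation q (x + y) z = polarisation q x z + polarisation q y z"
begin

lemma polarisation_commute: "polarisation q x y = polarisation q y x"
  by (simp add: polarisation_def ac_simps)

lemma polarisation_add_right:
  "x \<in> V \<Longrightarrow> y \<in> V \<Longrightarrow> z \<in> V \<Longrightarrow>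
    polarisation q z (x + y) = polarisation q z x + polarisation q z y"
  using polarisation_add polarisation_commute by metis

lemma add_eq_polarisation: "q (x + y) = q x + q y + polarisation q x y"
  by (cases "q x"; cases "q y"; cases "q (x + y)") (simp_all add: polarisation_def)

lemma q_zero [simp]: "q 0 = 0"
proof -
  have "polarisation q 0 0 = 0"
    using polarisation_add[OF zero_mem zero_mem zero_mem] by simp
  then show ?thesis by (simp add: polarisation_def)
qed

lemma polarisation_self [simp]: "polarisation q x x = 0"
  by (simp add: polarisation_def add_self)

lemma F2_subspace_radical: "F2_subspace (radical V q)"
proof
  have "polarisation q 0 y = 0" if "y \<in> V" for y
    using polarisation_add[OF zero_mem zero_mem that] by simp
  then show "0 \<in> radical V q" by (simp add: radical_def zero_mem)
qed (auto simp: radical_def finite_V add_self add_mem polarisation_add)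

text \<open>
  The modulus of a quadratic Gauss sum. In the double sum that expresses the square, the substitution
  of \<open>x + y\<close> for \<open>y\<close> leaves \<open>(-1)\<close> to the power \<open>q y + polarisation q y x\<close>. The summation over \<open>x\<close>
  then eliminates every \<open>y\<close> outside the radical, on which the remaining sum is again a character sum.
\<close>

lemma exp_sum_square:
  "(exp_sum V q)\<^sup>2 =
     int (card V) * (if \<forall>x\<in>radical V q. q x = 0 then int (card (radical V q)) else 0)"
proof -
  let ?b = "polarisation q"
  have "(exp_sum V q)\<^sup>2 = (\<Sum>x\<in>V. \<Sum>y\<in>V. bit_sign (q x) * bit_sign (q y))"
    by (simp add: exp_sum_def power2_eq_square sum_product)
  also have "\<dots> = (\<Sum>x\<in>V. \<Sum>y\<in>V. bit_sign (q x) * bit_sign (q (x + y)))"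
    by (intro sum.cong refl sum.reindex_bij_betw[OF bij_betw_translation, symmetric])
  also have "\<dots> = (\<Sum>x\<in>V. \<Sum>y\<in>V. bit_sign (q y) * bit_sign (?b y x))"
  proof (intro sum.cong refl)
    fix x y
    show "bit_sign (q x) * bit_sign (q (x + y)) = bit_sign (q y) * bit_sign (?b y x)"
      by (cases "q x"; cases "q y"; cases "q (x + y)")
         (simp_all add: polarisation_def add.commute[of y x])
  qed
  also have "\<dots> = (\<Sum>y\<in>V. bit_sign (q y) * exp_sum V (?b y))"
    by (subst sum.swap) (simp add: exp_sum_def sum_distrib_left)
  also have "\<dots> = (\<Sum>y\<in>V. bit_sign (q y) * (if y \<in> radical V q then int (card V) else 0))"
    by (intro sum.cong refl) (simp add: exp_sum_additive polarisation_add_right radical_def)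
  also have "\<dots> = (\<Sum>y\<in>radical V q. bit_sign (q y) * int (card V))"
    by (rule sum.mono_neutral_cong_right) (auto simp: finite_V radical_def)
  also have "\<dots> = int (card V) * exp_sum (radical V q) q"
    by (simp add: exp_sum_def sum_distrib_left mult.commute)
  also have "exp_sum (radical V q) q =
      (if \<forall>x\<in>radical V q. q x = 0 then int (card (radical V q)) else 0)"
    by (rule F2_subspace.exp_sum_additive[OF F2_subspace_radical])
       (simp add: add_eq_polarisation radical_def)
  finally show ?thesis .
qed

end

section \<open>Coordinates\<close>

definition additive_bij :: "('v::ab_group_add \<Rightarrow> 'w::ab_group_add) \<Rightarrow> 'v set \<Rightarrow> 'w set \<Rightarrow> bool" where
  "additive_bij \<phi> V W \<longleftrightarrow> bij_betw \<phi> V W \<and> (\<forall>x\<in>V. \<forall>y\<in>V. \<phi> (x + y) = \<phi> x + \<phi> y)"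

lemma qf_isometric_iff:
  "qf_isometric V q W q' \<longleftrightarrow> (\<exists>\<phi>. additive_bij \<phi> V W \<and> (\<forall>x\<in>V. q' (\<phi> x) = q x))"
  by (auto simp: qf_isometric_def additive_bij_def)

lemma exp_sum_isometric: "qf_isometric V q W q' \<Longrightarrow> exp_sum V q = exp_sum W q'"
proof -
  assume "qf_isometric V q W q'"
  then obtain \<phi> where \<phi>: "bij_betw \<phi> V W" "\<And>x. x \<in> V \<Longrightarrow> q' (\<phi> x) = q x"
    by (auto simp: qf_isometric_def)
  have "exp_sum W q' = (\<Sum>x\<in>V. bit_sign (q' (\<phi> x)))"
    unfolding exp_sum_def by (rule sum.reindex_bij_betw[OF \<phi>(1), symmetric])
  then show ?thesis by (simp add: exp_sum_def \<phi>(2))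
qed

text \<open>
  The coordinates of a vector with respect to a basis, extended by zero beyond the dimension.
\<close>

lemma (in F2_subspace) coordinates_exist:
  obtains \<phi> where "additive_bij \<phi> V (F2_space (dim2 V))"
proof -
  interpret vs: vector_space "scale2 :: bit \<Rightarrow> 'v \<Rightarrow> 'v"
    by (rule vector_space_scale2) (rule add_self)
  obtain B where B: "B \<subseteq> V" "vs.independent B" "V \<subseteq> vs.span B" "card B = vs.dim V"
    using vs.basis_exists by blast
  have "vs.subspace V"
    by (rule vs.subspaceI) (auto simp: scale2_def zero_mem add_mem)
  then have span: "vs.span B = V" using B(1,3) vs.span_minimal by blast
  have fin: "finite B" using B(1) finite_V finite_subset by blast
  define k where "k = card B"
  obtain e where e: "bij_betw e {..<k} B"
    using ex_bij_betw_nat_finite[OF fin] unfolding k_def by (auto simp: atLeast0LessThan)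
  have eB: "e i \<in> B" if "i < k" for i using bij_betwE[OF e] that by auto
  define \<phi> where "\<phi> v = (\<lambda>i. if i < k then vs.representation B v (e i) else 0)" for v
  define \<psi> where "\<psi> x = (\<Sum>i<k. scale2 (x i) (e i))" for x
  have psi_phi: "\<psi> (\<phi> v) = v" if "v \<in> V" for v
  proof -
    have "\<psi> (\<phi> v) = (\<Sum>b\<in>B. scale2 (vs.representation B v b) b)"
      unfolding \<psi>_def \<phi>_def
      by (subst sum.reindex_bij_betw[OF e, symmetric]) simp
    also have "\<dots> = v"
      by (rule vs.sum_representation_eq) (use B that fin in auto)
    finally show ?thesis .
  qed
  have psi_mem: "\<psi> x \<in> V" for x
    unfolding \<psi>_def span [symmetric]
    by (intro vs.span_sum vs.span_scale vs.span_base) (use eB in auto)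
  have phi_psi: "\<phi> (\<psi> x) = x" if x: "x \<in> F2_space k" for x
  proof
    fix i
    have "vs.representation B (\<psi> x) (e i) = x i" if i: "i < k"
    proof -
      define f where "f b = (if b \<in> B then x (inv_into {..<k} e b) else 0)" for b
      have fe: "f (e j) = x j" if "j < k" for j
        using e eB that unfolding f_def by (auto simp: bij_betw_inv_into_left)
      have "{b. f b \<noteq> 0} \<subseteq> B" by (auto simp: f_def split: if_splits)
      then have "vs.representation B (\<psi> x) = f"
      proof (intro vs.representation_eqI)
        show "\<psi> x \<in> vs.span B" using psi_mem span by simp
        show "finite {b. f b \<noteq> 0}" using \<open>{b. f b \<noteq> 0} \<subseteq> B\<close> fin finite_subset by blast
        have "(\<Sum>b | f b \<noteq> 0. scale2 (f b) b) = (\<Sum>b\<in>B. scale2 (f b) b)"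
          by (rule sum.mono_neutral_left) (use fin \<open>{b. f b \<noteq> 0} \<subseteq> B\<close> in \<open>auto simp: scale2_def\<close>)
        also have "\<dots> = \<psi> x"
          unfolding \<psi>_def by (subst sum.reindex_bij_betw[OF e, symmetric]) (simp add: fe)
        finally show "(\<Sum>b | f b \<noteq> 0. scale2 (f b) b) = \<psi> x" .
      qed (use B in \<open>auto simp: f_def split: if_splits\<close>)
      then show ?thesis using fe i by simp
    qed
    then show "\<phi> (\<psi> x) i = x i" using x by (auto simp: \<phi>_def F2_space_def)
  qed
  have "\<phi> v \<in> F2_space k" for v by (simp add: \<phi>_def F2_space_def)
  then have "bij_betw \<phi> V (F2_space k)"
    by (intro bij_betw_byWitness[where f' = \<psi>]) (auto simp: psi_phi phi_psi psi_mem)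
  moreover have "\<phi> (x + y) = \<phi> x + \<phi> y" if "x \<in> V" "y \<in> V" for x y
    using that B(2) span by (auto simp: \<phi>_def fun_eq_iff vs.representation_add)
  moreover have "k = dim2 V" using B(4) by (simp add: k_def dim2_def)
  ultimately show ?thesis using that[of \<phi>] by (auto simp: additive_bij_def)
qed

lemma card_F2_space: "card (F2_space k) = 2 ^ k"
proof -
  have "bij_betw (\<lambda>x. {i. x i = 1}) (F2_space k) (Pow {..<k})"
  proof (rule bij_betw_byWitness[where f' = "\<lambda>A i. if i \<in> A then 1 else 0"])
    show "\<forall>x\<in>F2_space k. (\<lambda>i. if i \<in> {i. x i = 1} then 1 else 0) = x"
      by (auto simp: fun_eq_iff F2_space_def)
  qed (auto simp: F2_space_def intro: leI)
  then show ?thesis by (simp add: bij_betw_same_card card_Pow)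
qed

lemma (in F2_subspace) card_eq_two_power_dim2: "card V = 2 ^ dim2 V"
  using coordinates_exist card_F2_space by (metis additive_bij_def bij_betw_same_card)

section \<open>Classification of quadratic forms over the field with two elements\<close>

text \<open>
  Adding a plane to a form already in normal form requires two new coordinates. Both normal forms are
  sums over the pairs of coordinates \<open>2 * i\<close> and \<open>2 * i + 1\<close> with \<open>i < s\<close>, followed by coordinates
  that do not occur. Inserting the new pair at position \<open>2 * s\<close> therefore treats both normal forms
  in the same way, and at position \<open>0\<close> it produces an elliptic plane.
\<close>

definition insert_pair :: "nat \<Rightarrow> bit \<Rightarrow> bit \<Rightarrow> (nat \<Rightarrow> bit) \<Rightarrow> nat \<Rightarrow> bit" where
  "insert_pair t a b x = (\<lambda>i. if i < t then x i else if i = t then a else if i = Suc t then b else x (i - 2))"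

lemma bij_betw_insert_pair:
  assumes "t \<le> k"
  shows "bij_betw (\<lambda>(a, b, x). insert_pair t a b x) (UNIV \<times> UNIV \<times> F2_space k) (F2_space (k + 2))"
proof -
  have "Suc (Suc (i - 2)) = i" if "\<not> i < t" "i \<noteq> t" "i \<noteq> Suc t" for i
    using that by arith
  then show ?thesis
    using assms
    by (intro bij_betw_byWitness[where f' =
          "\<lambda>y. (y t, y (Suc t), \<lambda>i. if i < t then y i else y (i + 2))"])
       (auto simp: insert_pair_def F2_space_def fun_eq_iff)
qed

lemma exp_sum_insert_pair:
  assumes "t \<le> k"
    and h: "\<And>a b x. h (insert_pair t a b x) = h' x + g a b"
  shows "exp_sum (F2_space (k + 2)) h =
    exp_sum (F2_space k) h' * (\<Sum>a\<in>UNIV. \<Sum>b\<in>UNIV. bit_sign (g a b))"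
proof -
  have "exp_sum (F2_space (k + 2)) h =
      (\<Sum>(a, b, x)\<in>UNIV \<times> UNIV \<times> F2_space k. bit_sign (h' x) * bit_sign (g a b))"
    unfolding exp_sum_def
    by (subst sum.reindex_bij_betw[OF bij_betw_insert_pair[OF assms(1)], symmetric])
       (simp add: case_prod_beta h bit_sign_add)
  also have "\<dots> = exp_sum (F2_space k) h' * (\<Sum>a\<in>UNIV. \<Sum>b\<in>UNIV. bit_sign (g a b))"
    by (simp add: UNIV_bit exp_sum_def sum_distrib_left sum_distrib_right distrib_left
        flip: sum.cartesian_product)
  finally show ?thesis .
qed

lemma insert_pair_simps [simp]:
  "i < t \<Longrightarrow> insert_pair t a b x i = x i"
  "insert_pair t a b x t = a"
  "insert_pair t a b x (Suc t) = b"
  by (simp_all add: insert_pair_def)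

lemma hyperbolic_form_insert_pair:
  "hyperbolic_form (2 * Suc s) (insert_pair (2 * s) a b x) = hyperbolic_form (2 * s) x + a * b"
  by (simp add: hyperbolic_form_def)

lemma elliptic_form_insert_pair:
  "s \<ge> 1 \<Longrightarrow>
    elliptic_form (2 * Suc s) (insert_pair (2 * s) a b x) = elliptic_form (2 * s) x + a * b"
  by (simp add: elliptic_form_def add.assoc del: power_bit_unfold)

lemma elliptic_form_insert_pair_0:
  "elliptic_form 2 (insert_pair 0 a b x) = a + a * b + b"
  by (cases a; cases b) (simp_all add: elliptic_form_def insert_pair_def)

text \<open>
  Each pair of coordinates contributes the factor \<open>2\<close>, which is the sum of \<open>(-1)\<close> to the power
  \<open>a * b\<close> over \<open>a\<close> and \<open>b\<close>, while each unused coordinate contributes the factor \<open>2\<close> by itself. In the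
  elliptic form the first pair contributes \<open>-2\<close> instead.
\<close>

lemma exp_sum_hyperbolic_form:
  "exp_sum (F2_space (2 * s + j)) (hyperbolic_form (2 * s)) = 2 ^ (s + j)"
proof (induction s)
  case 0
  then show ?case by (simp add: hyperbolic_form_def exp_sum_def card_F2_space)
next
  case (Suc s)
  have "exp_sum (F2_space ((2 * s + j) + 2)) (hyperbolic_form (2 * Suc s)) =
      2 ^ (s + j) * (\<Sum>a\<in>UNIV. \<Sum>b\<in>UNIV. bit_sign (a * b))"
    unfolding Suc [symmetric]
    by (rule exp_sum_insert_pair[where t = "2 * s"]) (simp_all only: hyperbolic_form_insert_pair le_add1)
  then show ?case by (simp add: UNIV_bit)
qed

lemma exp_sum_elliptic_form:
  assumes "s \<ge> 1"
  shows "exp_sum (F2_space (2 * s + j)) (elliptic_form (2 * s)) = - (2 ^ (s + j))"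
  using assms
proof (induction s rule: nat_induct_at_least)
  case base
  have "exp_sum (F2_space (j + 2)) (elliptic_form 2) =
      exp_sum (F2_space j) (\<lambda>_. 0) * (\<Sum>a\<in>UNIV. \<Sum>b\<in>UNIV. bit_sign (a + a * b + b))"
    by (rule exp_sum_insert_pair[where t = 0]) (simp_all add: elliptic_form_insert_pair_0)
  then show ?case by (simp add: UNIV_bit exp_sum_def card_F2_space numeral_2_eq_2 add.commute)
next
  case (Suc s)
  have "exp_sum (F2_space ((2 * s + j) + 2)) (elliptic_form (2 * Suc s)) =
      - (2 ^ (s + j)) * (\<Sum>a\<in>UNIV. \<Sum>b\<in>UNIV. bit_sign (a * b))"
    unfolding Suc.IH [symmetric]
    by (rule exp_sum_insert_pair[where t = "2 * s"])
       (simp_all only: elliptic_form_insert_pair[OF Suc.hyps] le_add1)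
  then show ?case by (simp add: UNIV_bit)
qed

lemma insert_pair_add:
  "insert_pair t a b x + insert_pair t a' b' y = insert_pair t (a + a') (b + b') (x + y)"
  by (auto simp: insert_pair_def fun_eq_iff)

context F2_quadratic_form
begin

text \<open>
  The orthogonal complement of the plane spanned by \<open>u\<close> and \<open>w\<close>. If \<open>polarisation q u w = 1\<close>, then
  \<open>V\<close> is the orthogonal sum of the two: \<open>plane_part v\<close> below is the component of \<open>v\<close> in the plane, and
  since \<open>-1 = 1\<close>, its complementary component is \<open>v + plane_part v\<close>.
\<close>

definition perp :: "'v \<Rightarrow> 'v \<Rightarrow> 'v set" where
  "perp u w = {x \<in> V. polarisation q x u = 0 \<and> polarisation q x w = 0}"

lemma F2_quadratic_form_perp:
  assumes "u \<in> V" "w \<in> V"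
  shows "F2_quadratic_form (perp u w) q"
proof
  have "polarisation q 0 y = 0" if "y \<in> V" for y
    using polarisation_add[OF zero_mem zero_mem that] by simp
  then show "0 \<in> perp u w" by (simp add: perp_def zero_mem assms)
qed (auto simp: perp_def finite_V add_self add_mem polarisation_add assms)

context
  fixes u w
  assumes u: "u \<in> V" and w: "w \<in> V" and uw: "polarisation q u w = 1"
begin

definition plane_vector :: "bit \<Rightarrow> bit \<Rightarrow> 'v" where
  "plane_vector a b = scale2 a u + scale2 b w"

definition plane_part :: "'v \<Rightarrow> 'v" where
  "plane_part v = plane_vector (polarisation q v w) (polarisation q v u)"

lemma plane_vector_mem: "plane_vector a b \<in> V"
  by (simp add: plane_vector_def scale2_def zero_mem add_mem u w)

lemma polarisation_plane_vector:
  "polarisation q (plane_vector a b) u = b" "polarisation q (plane_vector a b) w = a"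
  using u w uw polarisation_commute[of w u] polarisation_add[OF zero_mem zero_mem]
  by (cases a; cases b; simp add: plane_vector_def scale2_def polarisation_add)+

lemma plane_vector_add:
  "plane_vector a b + plane_vector a' b' = plane_vector (a + a') (b + b')"
proof -
  have "scale2 (c + c') x = scale2 c x + scale2 c' (x :: 'v)" for c c' x
    by (cases c; cases c') (simp_all add: scale2_def add_self)
  then show ?thesis by (simp add: plane_vector_def ac_simps)
qed

lemma q_plane_vector: "q (plane_vector a b) = a * q u + a * b + b * q w"
  using uw by (cases a; cases b) (simp_all add: plane_vector_def scale2_def add_eq_polarisation ac_simps)

lemma add_plane_part_mem_perp: "v \<in> V \<Longrightarrow> v + plane_part v \<in> perp u w"
  by (simp add: perp_def plane_part_def plane_vector_mem polarisation_plane_vector add_mem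
      polarisation_add u w)

lemma plane_part_add:
  "v \<in> V \<Longrightarrow> v' \<in> V \<Longrightarrow> plane_part (v + v') = plane_part v + plane_part v'"
  by (simp add: plane_part_def plane_vector_add polarisation_add u w)

lemma polarisation_perp_plane_vector:
  "v \<in> perp u w \<Longrightarrow> polarisation q v (plane_vector a b) = 0"
  using polarisation_add_right[OF zero_mem zero_mem]
  by (cases a; cases b) (simp_all add: plane_vector_def scale2_def perp_def polarisation_add_right u w)

text \<open>
  A vector orthogonal to the complement and, as an element of it, to the plane is orthogonal to all of
  \<open>V\<close>. This carries the hypothesis that \<open>q\<close> vanishes on the radical over to the complement.
\<close>

lemma radical_perp_subset: "radical (perp u w) q \<subseteq> radical V q"
proof
  fix x assume x: "x \<in> radical (perp u w) q"
  have "polarisation q x v = 0" if v: "v \<in> V" for v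
  proof -
    have "polarisation q x (v + plane_part v + plane_part v) = 0"
      using x add_plane_part_mem_perp[OF v] polarisation_perp_plane_vector[of x]
      by (subst polarisation_add_right)
         (auto simp: radical_def perp_def plane_part_def plane_vector_mem)
    then show ?thesis by (simp add: add.assoc add_self)
  qed
  then show "x \<in> radical V q" using x by (auto simp: radical_def perp_def)
qed

lemma card_perp_less: "card (perp u w) < card V"
proof (rule psubset_card_mono[OF finite_V])
  have "u \<notin> perp u w" by (simp add: perp_def uw)
  moreover have "perp u w \<subseteq> V" by (auto simp: perp_def)
  ultimately show "perp u w \<subset> V" using u by blast
qed

text \<open>
  Coordinates on the complement and the two coordinates in the plane form coordinates on \<open>V\<close>. In them
  \<open>q\<close> is the sum of its restrictions to the complement and to the plane.
\<close>

lemma coordinates_extend: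
  assumes \<psi>: "additive_bij \<psi> (perp u w) (F2_space k)" and "t \<le> k"
  obtains \<phi> where "additive_bij \<phi> V (F2_space (k + 2))"
    and "\<And>v. v \<in> V \<Longrightarrow> \<exists>v'\<in>perp u w. \<exists>a b.
      \<phi> v = insert_pair t a b (\<psi> v') \<and> q v = q v' + (a * q u + a * b + b * q w)"
proof -
  have bij: "bij_betw \<psi> (perp u w) (F2_space k)"
    and add: "\<And>x y. x \<in> perp u w \<Longrightarrow> y \<in> perp u w \<Longrightarrow> \<psi> (x + y) = \<psi> x + \<psi> y"
    using \<psi> by (auto simp: additive_bij_def)
  define \<phi> where "\<phi> v =
    insert_pair t (polarisation q v w) (polarisation q v u) (\<psi> (v + plane_part v))" for v
  have ins: "bij_betw (\<lambda>(a, b, x). insert_pair t a b x) (UNIV \<times> UNIV \<times> F2_space k) (F2_space (k + 2))"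
    by (rule bij_betw_insert_pair) fact
  have split: "bij_betw (\<lambda>v. (polarisation q v w, polarisation q v u, v + plane_part v))
      V (UNIV \<times> UNIV \<times> perp u w)"
  proof (rule bij_betw_byWitness[where f' = "\<lambda>(a, b, x). x + plane_vector a b"])
    have "plane_part (x + plane_vector a b) = plane_vector a b" if "x \<in> perp u w" for x a b
      using that by (simp add: plane_part_def perp_def polarisation_add plane_vector_mem u w
          polarisation_plane_vector)
    then show "\<forall>y\<in>UNIV \<times> UNIV \<times> perp u w.
      (\<lambda>v. (polarisation q v w, polarisation q v u, v + plane_part v))
        ((\<lambda>(a, b, x). x + plane_vector a b) y) = y"
      by (auto simp: perp_def polarisation_add plane_vector_mem u w polarisation_plane_vector
          add.assoc add_self)
  qed (auto simp: plane_part_def [symmetric] add.assoc add_self add_plane_part_mem_perp,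
       auto simp: perp_def plane_vector_mem add_mem)
  have "bij_betw (map_prod id (map_prod id \<psi>))
      (UNIV \<times> UNIV \<times> perp u w) (UNIV \<times> UNIV \<times> F2_space k)"
    by (intro bij_betw_map_prod bij_betw_id bij)
  from bij_betw_trans[OF split bij_betw_trans[OF this ins]]
  have "bij_betw \<phi> V (F2_space (k + 2))"
    by (simp add: o_def \<phi>_def[abs_def])
  moreover have "\<phi> (x + y) = \<phi> x + \<phi> y" if "x \<in> V" "y \<in> V" for x y
  proof -
    have "x + y + plane_part (x + y) = (x + plane_part x) + (y + plane_part y)"
      using that by (simp add: plane_part_add ac_simps)
    then show ?thesis
      unfolding \<phi>_def insert_pair_add
      by (simp only: that polarisation_add u w add add_plane_part_mem_perp)
  qed
  moreover have "\<exists>v'\<in>perp u w. \<exists>a b.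
      \<phi> v = insert_pair t a b (\<psi> v') \<and> q v = q v' + (a * q u + a * b + b * q w)" if "v \<in> V" for v
  proof (intro bexI exI conjI)
    let ?v' = "v + plane_part v"
    show "?v' \<in> perp u w" using that by (rule add_plane_part_mem_perp)
    then have "q (?v' + plane_part v) = q ?v' + q (plane_part v)"
      by (subst add_eq_polarisation) (simp add: plane_part_def polarisation_perp_plane_vector)
    then show "q v = q ?v' + (polarisation q v w * q u +
        polarisation q v w * polarisation q v u + polarisation q v u * q w)"
      by (simp add: add.assoc add_self) (simp add: plane_part_def q_plane_vector add.assoc)
  qed (simp add: \<phi>_def)
  ultimately show ?thesis using that[of \<phi>] by (auto simp: additive_bij_def)
qed

end

end

text \<open>
  As long as there are orthogonal complements of planes with \<open>q u = q w = 0\<close> and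
  \<open>polarisation q u w = 1\<close>, such hyperbolic planes are split off. Suppose that none exists, but that
  \<open>polarisation q u w = 1\<close> for some \<open>u\<close> and \<open>w\<close>. Then \<open>q\<close> takes the value \<open>1\<close> at both vectors of every
  such pair, so the plane of \<open>u\<close> and \<open>w\<close> is elliptic. Two orthogonal elliptic planes would contain a
  hyperbolic pair, as the sum of a vector from each is a zero of \<open>q\<close>. Hence the polarisation
  vanishes on the complement, and a single elliptic plane remains.
\<close>

lemma quadratic_form_classification:
  fixes V :: "'v::ab_group_add set"
  assumes "F2_quadratic_form V q" and "\<forall>x\<in>radical V q. q x = 0"
  obtains (hyperbolic) s j where "qf_isometric V q (F2_space (2 * s + j)) (hyperbolic_form (2 * s))"
  | (elliptic) s j where "s \<ge> 1" "qf_isometric V q (F2_space (2 * s + j)) (elliptic_form (2 * s))"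
proof -
  have "\<exists>s j. qf_isometric V q (F2_space (2 * s + j)) (hyperbolic_form (2 * s)) \<or>
      s \<ge> 1 \<and> qf_isometric V q (F2_space (2 * s + j)) (elliptic_form (2 * s))"
    if "F2_quadratic_form V q" "\<forall>x\<in>radical V q. q x = 0" for V :: "'v set"
    using that
  proof (induction "card V" arbitrary: V rule: less_induct)
    case less
    interpret F2_quadratic_form V q by fact
    consider (degenerate) "\<forall>u\<in>V. \<forall>w\<in>V. polarisation q u w = 0"
      | (plane) u w where "u \<in> V" "w \<in> V" "polarisation q u w = 1" "q u = 0" "q w = 0"
      | (anisotropic) u w where "u \<in> V" "w \<in> V" "polarisation q u w = 1"
          "\<forall>u\<in>V. \<forall>w\<in>V. polarisation q u w = 1 \<longrightarrow> q u = 1 \<and> q w = 1"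
    proof -
      have *: thesis if uw: "u \<in> V" "w \<in> V" "polarisation q u w = 1" "q u = 0" for u w
      proof (cases "q w = 0")
        case True
        then show ?thesis using plane uw by blast
      next
        case False
        then have 1: "q w = 1" by simp
        \<comment> \<open>The vectors \<open>u\<close> and \<open>u + w\<close> form a hyperbolic pair in the same plane.\<close>
        have "polarisation q u (u + w) = 1" "q (u + w) = 0"
          using uw 1 by (simp_all add: polarisation_add_right add_eq_polarisation)
        then show ?thesis using plane uw add_mem by blast
      qed
      show thesis
      proof (cases "\<exists>u\<in>V. \<exists>w\<in>V. polarisation q u w = 1 \<and> (q u = 0 \<or> q w = 0)")
        case True
        then show thesis using * polarisation_commute by metis
      next
        case False
        then have "\<forall>u\<in>V. \<forall>w\<in>V. polarisation q u w = 1 \<longrightarrow> q u = 1 \<and> q w = 1"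
          by (meson bit_not_zero_iff)
        then show thesis using degenerate anisotropic by (meson bit_not_zero_iff)
      qed
    qed
    then show ?case
    proof cases
      case degenerate
      then have "radical V q = V" by (auto simp: radical_def)
      then have "\<forall>x\<in>V. q x = 0" using less.prems by simp
      moreover obtain \<phi> where "additive_bij \<phi> V (F2_space (dim2 V))" by (rule coordinates_exist)
      ultimately have "qf_isometric V q (F2_space (2 * 0 + dim2 V)) (hyperbolic_form (2 * 0))"
        by (auto simp: qf_isometric_iff hyperbolic_form_def)
      then show ?thesis by blast
    next
      case (plane u w)
      have "\<exists>s j. qf_isometric (perp u w) q (F2_space (2 * s + j)) (hyperbolic_form (2 * s)) \<or>
          s \<ge> 1 \<and> qf_isometric (perp u w) q (F2_space (2 * s + j)) (elliptic_form (2 * s))"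
        using plane less.prems radical_perp_subset[of u w]
        by (intro less.hyps card_perp_less F2_quadratic_form_perp) auto
      then obtain s j h where iso: "qf_isometric (perp u w) q (F2_space (2 * s + j)) (h (2 * s))"
        and h: "h = hyperbolic_form \<or> s \<ge> 1 \<and> h = elliptic_form" by blast
      from iso obtain \<psi> where \<psi>: "additive_bij \<psi> (perp u w) (F2_space (2 * s + j))"
        "\<And>x. x \<in> perp u w \<Longrightarrow> h (2 * s) (\<psi> x) = q x"
        by (auto simp: qf_isometric_iff)
      have "2 * s \<le> 2 * s + j" by simp
      from coordinates_extend[OF plane(1-3) \<psi>(1) this] obtain \<phi>
        where \<phi>: "additive_bij \<phi> V (F2_space (2 * s + j + 2))"
          and dec: "\<And>v. v \<in> V \<Longrightarrow> \<exists>v'\<in>perp u w. \<exists>a b.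
            \<phi> v = insert_pair (2 * s) a b (\<psi> v') \<and> q v = q v' + (a * q u + a * b + b * q w)"
        by blast
      have "h (2 * Suc s) (insert_pair (2 * s) a b x) = h (2 * s) x + a * b" for a b x
        using h hyperbolic_form_insert_pair elliptic_form_insert_pair by blast
      then have "h (2 * Suc s) (\<phi> v) = q v" if "v \<in> V" for v
        using dec[OF that] \<psi>(2) plane(4,5) by auto
      moreover have "2 * s + j + 2 = 2 * Suc s + j" by simp
      ultimately have "qf_isometric V q (F2_space (2 * Suc s + j)) (h (2 * Suc s))"
        using \<phi> unfolding qf_isometric_iff by metis
      then show ?thesis using h by (metis le_add1 plus_1_eq_Suc)
    next
      case (anisotropic u w)
      interpret P: F2_quadratic_form "perp u w" q
        using anisotropic(1,2) by (rule F2_quadratic_form_perp)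
      have "polarisation q x y = 0" if xy: "x \<in> perp u w" "y \<in> perp u w" for x y
      proof (rule ccontr)
        assume "polarisation q x y \<noteq> 0"
        then have 1: "polarisation q x y = 1" by simp
        have V: "x \<in> V" "y \<in> V" "polarisation q x u = 0" "polarisation q x w = 0"
          using xy by (auto simp: perp_def)
        \<comment> \<open>The zero \<open>x + u\<close> of \<open>q\<close> pairs non-trivially with \<open>w\<close>.\<close>
        have "q x = 1" "q u = 1" using anisotropic 1 V by blast+
        then have "q (x + u) = 0" using V by (simp add: add_eq_polarisation)
        moreover have "polarisation q (x + u) w = 1" using V anisotropic by (simp add: polarisation_add)
        ultimately show False using anisotropic V add_mem by (metis zero_neq_one)
      qed
      then have "radical (perp u w) q = perp u w" by (auto simp: radical_def)
      then have 0: "q x = 0" if "x \<in> perp u w" for x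
        using radical_perp_subset[OF anisotropic(1-3)] less.prems(2) that by auto
      obtain \<psi> where \<psi>: "additive_bij \<psi> (perp u w) (F2_space (dim2 (perp u w)))"
        by (rule P.coordinates_exist)
      define j where "j = dim2 (perp u w)"
      from coordinates_extend[OF anisotropic(1-3) \<psi>, of 0] obtain \<phi>
        where \<phi>: "additive_bij \<phi> V (F2_space (j + 2))"
          and dec: "\<And>v. v \<in> V \<Longrightarrow> \<exists>v'\<in>perp u w. \<exists>a b.
            \<phi> v = insert_pair 0 a b (\<psi> v') \<and> q v = q v' + (a * q u + a * b + b * q w)"
        unfolding j_def by blast
      have "q u = 1" "q w = 1" using anisotropic by blast+
      then have "elliptic_form 2 (\<phi> v) = q v" if "v \<in> V" for v
        using dec[OF that] 0 by (auto simp: elliptic_form_insert_pair_0)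
      then have "qf_isometric V q (F2_space (2 * 1 + j)) (elliptic_form (2 * 1))"
        using \<phi> by (auto simp: qf_isometric_iff add.commute numeral_2_eq_2)
      then show ?thesis by blast
    qed
  qed
  from this[OF assms] show ?thesis
    using hyperbolic elliptic by blast
qed

text \<open>
  The two normal forms have exponential sums of opposite sign, so the sign tells them apart. It
  remains to see that the number \<open>r\<close> in the definition of \<^const>\<open>qf_eps\<close> is the number \<open>2 * s\<close> from the
  classification: comparing the absolute value \<open>2 ^ (s + j)\<close> of the sum with \<open>exp_sum_square\<close> shows
  that the radical has dimension \<open>j\<close>.
\<close>

lemma (in F2_quadratic_form) qf_eps_eq_sgn_exp_sum: "qf_eps V q = sgn (exp_sum V q)"
proof (cases "\<forall>x\<in>radical V q. q x = 0")
  case False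
  have "(exp_sum V q)\<^sup>2 = 0"
    by (simp only: exp_sum_square if_not_P[OF False] mult_zero_right)
  then show ?thesis using False by (auto simp: qf_eps_def)
next
  case True
  define k c where "k = dim2 V" and "c = dim2 (radical V q)"
  have sq: "(exp_sum V q)\<^sup>2 = 2 ^ (k + c)"
    using True exp_sum_square card_eq_two_power_dim2
      F2_subspace.card_eq_two_power_dim2[OF F2_subspace_radical]
    by (simp add: k_def c_def power_add)
  have rank: "k = 2 * s + j \<and> c = j"
    if iso: "qf_isometric V q (F2_space (2 * s + j)) h" and S: "\<bar>exp_sum V q\<bar> = 2 ^ (s + j)" for s j h
  proof -
    have "card V = card (F2_space (2 * s + j))"
      using iso bij_betw_same_card by (auto simp: qf_isometric_def)
    then have k: "k = 2 * s + j"
      using card_eq_two_power_dim2 by (simp add: card_F2_space k_def)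
    have "(2::int) ^ (k + c) = (2 ^ (s + j))\<^sup>2"
      using sq S by (metis power2_abs)
    then have "k + c = (s + j) * 2" by (simp flip: power_mult)
    then show ?thesis using k by simp
  qed
  show ?thesis
  proof (cases rule: quadratic_form_classification[OF F2_quadratic_form_axioms True])
    case (1 s j)
    have S: "exp_sum V q = 2 ^ (s + j)"
      using exp_sum_isometric[OF 1] by (simp add: exp_sum_hyperbolic_form)
    then have "k = 2 * s + j \<and> c = j" by (intro rank[OF 1]) simp
    then show ?thesis using True 1 S by (simp add: qf_eps_def Let_def flip: k_def c_def)
  next
    case (2 s j)
    have S: "exp_sum V q = - (2 ^ (s + j))"
      using exp_sum_isometric[OF 2(2)] 2(1) by (simp add: exp_sum_elliptic_form)
    then have kc: "k = 2 * s + j \<and> c = j" by (intro rank[OF 2(2)]) simp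
    have "\<not> qf_isometric V q (F2_space (2 * s + j)) (hyperbolic_form (2 * s))"
    proof
      assume "qf_isometric V q (F2_space (2 * s + j)) (hyperbolic_form (2 * s))"
      then have "exp_sum V q = 2 ^ (s + j)"
        by (simp add: exp_sum_isometric exp_sum_hyperbolic_form)
      then show False using S by (simp add: eq_neg_iff_add_eq_0)
    qed
    then show ?thesis using True 2 S kc by (simp add: qf_eps_def Let_def flip: k_def c_def)
  qed
qed

section \<open>Orbits of prime order and the character modulo 8\<close>

text \<open>
  If \<open>s ^^ k\<close> fixes \<open>x\<close> and \<open>k\<close> is invertible modulo \<open>p\<close>, then \<open>s\<close> itself is, at \<open>x\<close>, an iterate of
  \<open>s ^^ k\<close>, so \<open>x\<close> is a fixed point.
\<close>

lemma iterate_periodic_orbit_inj: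
  assumes p: "prime p" and per: "(s ^^ p) x = x" and nfix: "s x \<noteq> x"
  shows "inj_on (\<lambda>i. (s ^^ i) x) {..<p}"
proof -
  have nper: "(s ^^ k) x \<noteq> x" if k: "0 < k" "k < p" for k
  proof
    assume fix_k: "(s ^^ k) x = x"
    have "coprime k p" using p k by (meson coprime_commute prime_imp_coprime nat_dvd_not_less)
    then obtain u where u: "[k * u = 1] (mod p)" using cong_solve_coprime_nat by auto
    have "x = (s ^^ (k * u)) x"
      using fix_k by (induction u) (simp_all add: funpow_add)
    also have "\<dots> = (s ^^ ((k * u) mod p)) x" by (rule funpow_mod_eq[OF per, symmetric])
    also have "(k * u) mod p = 1" using u prime_gt_1_nat[OF p] by (simp add: cong_def)
    finally show False using nfix by simp
  qed
  have "False" if ij: "i < j" "j < p" "(s ^^ i) x = (s ^^ j) x" for i j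
  proof -
    have "(s ^^ (p - i)) ((s ^^ i) x) = (s ^^ (p - i)) ((s ^^ j) x)" using ij by simp
    also have "\<dots> = (s ^^ (p - i + j)) x" by (simp add: funpow_add)
    also have "p - i + j = (j - i) + p" using ij by simp
    also have "(s ^^ ((j - i) + p)) x = (s ^^ (j - i)) x" by (simp only: funpow_add o_apply per)
    also have "(s ^^ (p - i)) ((s ^^ i) x) = (s ^^ (p - i + i)) x" by (simp only: funpow_add o_apply)
    also have "p - i + i = p" using ij by simp
    finally have "(s ^^ (j - i)) x = x" using per by simp
    moreover have "0 < j - i" "j - i < p" using ij by auto
    ultimately show False using nper by blast
  qed
  then show ?thesis by (intro linorder_inj_onI) auto
qed

text \<open>
  Every orbit without a fixed point has \<open>p\<close> elements, on which the invariant function \<open>g\<close> is constant,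
  and contributes a multiple of \<open>p\<close>. The induction removes one such orbit at a time.
\<close>

lemma sum_cong_sum_fixed_points:
  fixes g :: "'a \<Rightarrow> int"
  assumes p: "prime p" and "finite X"
    and "\<And>x. x \<in> X \<Longrightarrow> s x \<in> X"
    and "\<And>x. x \<in> X \<Longrightarrow> (s ^^ p) x = x"
    and "\<And>x. x \<in> X \<Longrightarrow> g (s x) = g x"
  shows "[sum g X = sum g {x \<in> X. s x = x}] (mod int p)"
  using assms(2-)
proof (induction "card X" arbitrary: X rule: less_induct)
  case less
  show ?case
  proof (cases "\<forall>x\<in>X. s x = x")
    case True
    then have "{x \<in> X. s x = x} = X" by auto
    then show ?thesis by simp
  next
    case False
    then obtain x where x: "x \<in> X" "s x \<noteq> x" by auto
    define C where "C = (\<lambda>i. (s ^^ i) x) ` {..<p}"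
    have p0: "p > 0" using p prime_gt_0_nat by auto
    have iter: "(s ^^ i) x \<in> X \<and> g ((s ^^ i) x) = g x" for i
      using x(1) less.prems(2,4) by (induction i) auto
    have iter_C: "(s ^^ i) x \<in> C" for i
      unfolding C_def funpow_mod_eq[OF less.prems(3)[OF x(1)], symmetric, of i] using p0 by auto
    have C: "C \<subseteq> X" "finite C" "x \<in> C" using iter iter_C[of 0] by (auto simp: C_def)
    have "sum g C = (\<Sum>i<p. g ((s ^^ i) x))"
      unfolding C_def using iterate_periodic_orbit_inj[OF p less.prems(3)[OF x(1)] x(2)]
      by (simp add: sum.reindex)
    then have sum_C: "sum g C = int p * g x" using iter by simp
    have fix_C: "s y \<noteq> y" if y: "y \<in> C" for y
    proof
      assume "s y = y"
      then have "(s ^^ k) y = y" for k by (induction k) auto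
      moreover obtain i where i: "y = (s ^^ i) x" "i < p" using y by (auto simp: C_def)
      ultimately have "y = (s ^^ (p - i)) ((s ^^ i) x)" by metis
      also have "\<dots> = (s ^^ (p - i + i)) x" by (simp only: funpow_add o_apply)
      finally show False using i(2) less.prems(3)[OF x(1)] x(2) \<open>s y = y\<close> by simp
    qed
    have inv_C: "y \<in> C" if y: "y \<in> X" "s y \<in> C" for y
    proof -
      obtain i where i: "s y = (s ^^ i) x" using y(2) by (auto simp: C_def)
      have "y = (s ^^ (p - 1)) (s y)"
        using less.prems(3)[OF y(1)] p0 by (metis Suc_pred' funpow_swap1 funpow_simps_right(2) o_apply)
      then show ?thesis unfolding i using iter_C by (metis funpow_add o_apply)
    qed
    have "[sum g (X - C) = sum g {y \<in> X - C. s y = y}] (mod int p)"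
    proof (rule less.hyps)
      show "card (X - C) < card X" using C x less.prems(1) by (intro psubset_card_mono) auto
    qed (use less.prems inv_C in auto)
    moreover have "{y \<in> X - C. s y = y} = {y \<in> X. s y = y}" using fix_C by auto
    moreover have "sum g X = sum g (X - C) + int p * g x"
      using C(1) less.prems(1) sum_C sum.subset_diff by metis
    ultimately show ?thesis by (simp add: cong_def)
  qed
qed

lemma chi8_mult: "chi8 (a * b) = chi8 a * chi8 b"
proof -
  have *: "chi8 k = chi8 (k mod 8)" for k by (simp add: chi8_def)
  have "\<forall>r\<in>{..<8}. \<forall>s\<in>{..<8}. chi8 (r * s) = chi8 r * chi8 s"
    by (simp add: chi8_def lessThan_nat_numeral lessThan_Suc)
  then have "chi8 ((a mod 8) * (b mod 8)) = chi8 (a mod 8) * chi8 (b mod 8)" by simp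
  then show ?thesis using *[of a] *[of b] *[of "a * b"] *[of "(a mod 8) * (b mod 8)"]
    by (simp add: mod_mult_eq)
qed

lemma chi8_odd: "odd a \<Longrightarrow> chi8 a = 1 \<or> chi8 a = -1"
proof -
  assume "odd a"
  then have "a mod 8 = 1 \<or> a mod 8 = 3 \<or> a mod 8 = 5 \<or> a mod 8 = 7" by presburger
  then show ?thesis by (auto simp: chi8_def)
qed

text \<open>
  The second supplement to quadratic reciprocity. In Gauss's lemma for the multiplier \<open>2\<close>, with
  \<open>p = 2 * h + 1\<close>, the products \<open>2 * j\<close> for \<open>1 \<le> j \<le> h\<close> are already reduced modulo \<open>p\<close>. Those
  exceeding \<open>h\<close> belong to \<open>j > h div 2\<close>, so the exponent of \<open>-1\<close> is \<open>h - h div 2\<close>.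
\<close>

lemma two_power_cong_chi8:
  assumes p: "prime p" "odd p"
  shows "[2 ^ ((p - 1) div 2) = chi8 p] (mod int p)"
proof -
  have p2: "p > 2" using p prime_ge_2_nat[of p] by (cases "p = 2") auto
  define h where "h = (p - 1) div 2"
  have ph: "p = 2 * h + 1" using p(2) p2 by (simp add: h_def)
  interpret GAUSS p 2
    using p p2 by unfold_locales (auto simp: cong_def)
  have hA: "(int p - 1) div 2 = int h" using ph by simp
  have "E = (\<lambda>j. 2 * int j) ` {h div 2<..h}"
  proof (intro equalityI subsetI)
    fix y assume "y \<in> E"
    then obtain x where x: "0 < x" "x \<le> int h" "y = (x * 2) mod int p" "int h < y"
      unfolding E_def C_def B_def A_def hA by auto
    moreover have "(x * 2) mod int p = x * 2" using x ph by (intro mod_pos_pos_trivial) auto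
    ultimately show "y \<in> (\<lambda>j. 2 * int j) ` {h div 2<..h}"
      by (intro image_eqI[of _ _ "nat x"]) auto
  next
    fix y assume "y \<in> (\<lambda>j. 2 * int j) ` {h div 2<..h}"
    then obtain j where j: "h div 2 < j" "j \<le> h" "y = 2 * int j" by auto
    have "(int j * 2) mod int p = int j * 2" using j ph by (intro mod_pos_pos_trivial) auto
    moreover have "int j * 2 \<in> B" using j unfolding B_def A_def hA by auto
    ultimately have "y \<in> C" unfolding C_def using j by (metis image_eqI mult.commute)
    then show "y \<in> E" unfolding E_def hA using j by auto
  qed
  then have "card E = h - h div 2" by (simp add: card_image inj_on_def)
  moreover have "(-1) ^ (h - h div 2) = chi8 p"
  proof -
    consider t where "h = 4 * t" | t where "h = 4 * t + 1"
      | t where "h = 4 * t + 2" | t where "h = 4 * t + 3"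
    proof -
      have "h mod 4 < 4" by simp
      then have "h mod 4 = 0 \<or> h mod 4 = 1 \<or> h mod 4 = 2 \<or> h mod 4 = 3" by linarith
      then show thesis using that mult_div_mod_eq[of 4 h] by (metis add_0_right)
    qed
    then show ?thesis
    proof cases
      case (1 t)
      then have "h - h div 2 = 2 * t" "p = 8 * t + 1" using ph by auto
      then show ?thesis by (simp add: chi8_def)
    next
      case (2 t)
      then have "h - h div 2 = 2 * t + 1" "p = 8 * t + 3" using ph by auto
      then show ?thesis by (simp add: chi8_def)
    next
      case (3 t)
      then have "h - h div 2 = 2 * t + 1" "p = 8 * t + 5" using ph by auto
      then show ?thesis by (simp add: chi8_def)
    next
      case (4 t)
      then have "h - h div 2 = 2 * (t + 1)" "p = 8 * t + 7" using ph by auto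
      then show ?thesis by (simp add: chi8_def)
    qed
  qed
  ultimately show ?thesis using pre_gauss_lemma by (simp add: hA h_def)
qed

section \<open>Traces in finite fields of characteristic two\<close>

lemma of_bit_add:
  assumes "CHAR('k::field) = 2"
  shows "(of_bit (b + c) :: 'k) = of_bit b + of_bit c"
  by (cases b; cases c) (simp_all add: char2_add_self[OF assms])

lemma char2_sum_power:
  assumes "CHAR('k::field) = 2"
  shows "(\<Sum>i\<in>A. g i :: 'k) ^ (2 ^ n) = (\<Sum>i\<in>A. g i ^ (2 ^ n))"
  by (induction A rule: infinite_finite_induct) (simp_all add: char2_add_power[OF assms])

lemma GF2_power: "x \<in> GF2 M \<Longrightarrow> x ^ (2 ^ (M * k)) = (x :: 'k::field)"
  by (induction k) (simp_all add: GF2_def power_add power_mult)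

lemma GF2_mono: "M dvd n \<Longrightarrow> GF2 M \<subseteq> (GF2 n :: 'k::field set)"
  using GF2_power by (force simp: GF2_def)

text \<open>
  The exponents \<open>n\<close> with \<open>x \<in> GF2 n\<close> are closed under remainders, so Euclid's algorithm applies.
\<close>

lemma GF2_Int: "x \<in> GF2 a \<Longrightarrow> x \<in> GF2 b \<Longrightarrow> (x :: 'k::field) \<in> GF2 (gcd a b)"
proof (induction a b rule: gcd_nat_induct)
  case (step a b)
  have "x ^ (2 ^ a) = x ^ (2 ^ (b * (a div b)) * 2 ^ (a mod b))"
    by (simp flip: power_add)
  also have "\<dots> = (x ^ (2 ^ (b * (a div b)))) ^ (2 ^ (a mod b))" by (rule power_mult)
  also have "\<dots> = x ^ (2 ^ (a mod b))"
    by (simp only: GF2_power[OF step.prems(2)])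
  finally have "x \<in> GF2 (a mod b)" using step.prems(1) by (simp add: GF2_def)
  then show ?case using step by (simp add: gcd_red_nat[of a b])
qed simp

lemma conj_sum_add:
  assumes "CHAR('k::field) = 2"
  shows "conj_sum n ((x::'k) + y) = conj_sum n x + conj_sum n y"
  by (simp add: conj_sum_def char2_add_power[OF assms] sum.distrib)

lemma conj_sum_sum:
  assumes "CHAR('k::field) = 2"
  shows "conj_sum n (\<Sum>i\<in>A. g i :: 'k) = (\<Sum>i\<in>A. conj_sum n (g i))"
  by (simp add: conj_sum_def char2_sum_power[OF assms] sum.swap[of _ A])

lemma conj_sum_frobenius:
  assumes "(x::'k::field) \<in> GF2 n"
  shows "conj_sum n (x ^ (2 ^ j)) = conj_sum n x"
proof (induction j)
  case (Suc j)
  have "conj_sum n (y\<^sup>2) = conj_sum n y" if "y \<in> GF2 n" for y :: 'k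
  proof -
    have "y + conj_sum n (y\<^sup>2) = (\<Sum>i<Suc n. y ^ (2 ^ i))"
      unfolding sum.lessThan_Suc_shift by (simp add: conj_sum_def power_mult)
    also have "\<dots> = y + conj_sum n y"
      using that by (simp add: GF2_def conj_sum_def)
    finally show ?thesis by simp
  qed
  moreover have "x ^ (2 ^ j) \<in> GF2 n"
    using assms unfolding GF2_def by (simp flip: power_mult) (metis mult.commute power_mult)
  ultimately show ?case using Suc by (simp only: power_Suc2 power_mult)
qed simp

lemma conj_sum_plus_degree: "conj_sum (M + n) x = conj_sum M x + conj_sum n (x ^ (2 ^ M))"
  by (induction n) (simp_all add: conj_sum_def power_add power_mult add.assoc)

lemma conj_sum_mult_degree:
  assumes x: "(x::'k::field) \<in> GF2 M"
  shows "conj_sum (M * k) x = of_nat k * conj_sum M x"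
proof (induction k)
  case (Suc k)
  have "conj_sum (M * Suc k) x = conj_sum (M * k + M) x" by (simp add: add.commute)
  also have "\<dots> = conj_sum (M * k) x + conj_sum M x"
    by (simp only: conj_sum_plus_degree GF2_power[OF x])
  finally show ?case by (simp add: Suc distrib_right add.commute)
qed (simp add: conj_sum_def)

text \<open>
  The trace from the field with \<open>2 ^ (M * k)\<close> elements multiplies elements of the subfield by \<open>k\<close>,
  which is \<open>1\<close> in characteristic two.
\<close>

lemma abs_trace_mult_odd:
  assumes "CHAR('k::field) = 2" "(x::'k) \<in> GF2 M" "odd k"
  shows "abs_trace (M * k) x = abs_trace M x"
proof -
  obtain r where "k = 2 * r + 1" using assms(3) oddE by blast
  moreover have "of_nat (2 * r) = (0::'k)"
    by (simp only: of_nat_eq_0_iff_char_dvd assms(1) dvd_triv_left)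
  ultimately have "of_nat k = (1::'k)" by simp
  then show ?thesis
    unfolding abs_trace_def conj_sum_mult_degree[OF assms(2)] by simp
qed

lemma abs_trace_cong_conj_sum: "conj_sum n x = conj_sum n y \<Longrightarrow> abs_trace n x = abs_trace n y"
  by (simp add: abs_trace_def)

context
  assumes char2: "CHAR('k::alg_closed_field) = 2"
begin

lemma GF2_closed:
  fixes x y :: 'k
  shows "x \<in> GF2 n \<Longrightarrow> y \<in> GF2 n \<Longrightarrow> x + y \<in> GF2 n"
    "x \<in> GF2 n \<Longrightarrow> y \<in> GF2 n \<Longrightarrow> x * y \<in> GF2 n"
    "x \<in> GF2 n \<Longrightarrow> inverse x \<in> GF2 n"
    "(0::'k) \<in> GF2 n"
  using is_subfield_GF2[OF char2, of n] by (auto simp: is_subfield_def)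

lemma GF2_closed_power: "(x::'k) \<in> GF2 n \<Longrightarrow> x ^ j \<in> GF2 n"
  by (induction j) (use is_subfield_GF2[OF char2, of n] in \<open>auto simp: is_subfield_def\<close>)

lemma GF2_closed_sum: "(\<And>i. i \<in> A \<Longrightarrow> (g i :: 'k) \<in> GF2 n) \<Longrightarrow> sum g A \<in> GF2 n"
  by (induction A rule: infinite_finite_induct) (auto intro: GF2_closed)

lemma finite_GF2: "n > 0 \<Longrightarrow> finite (GF2 n :: 'k set)"
  using card_GF2[OF char2] by (metis card.infinite power_not_zero zero_neq_numeral)

lemma F2_subspace_GF2: "n > 0 \<Longrightarrow> F2_subspace (GF2 n :: 'k set)"
  by (rule F2_subspace.intro)
     (auto intro: GF2_closed finite_GF2 simp only: char2_add_self[OF char2])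

lemma abs_trace_add:
  assumes "(x::'k) \<in> GF2 n" "y \<in> GF2 n"
  shows "abs_trace n (x + y) = abs_trace n x + abs_trace n y"
proof -
  have "(of_bit (abs_trace n (x + y)) :: 'k) = of_bit (abs_trace n x + abs_trace n y)"
    unfolding of_bit_add[OF char2] using assms
    by (simp only: of_bit_abs_trace[OF char2] GF2_closed(1) conj_sum_add[OF char2])
  then show ?thesis
    by (cases "abs_trace n (x + y)"; cases "abs_trace n x + abs_trace n y") simp_all
qed

text \<open>
  As a polynomial function the trace has degree below \<open>2 ^ n\<close>, so it is not zero on the whole field.
\<close>

lemma abs_trace_nondegenerate:
  assumes "n > 0" and w: "(w::'k) \<in> GF2 n" "w \<noteq> 0"
  obtains z where "z \<in> GF2 n" "abs_trace n (z * w) = 1"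
proof -
  define P :: "'k poly" where "P = (\<Sum>i<n. monom 1 (2 ^ i))"
  have poly_P: "poly P y = conj_sum n y" for y
    by (simp add: P_def poly_sum poly_monom conj_sum_def)
  have "degree P \<le> 2 ^ (n - 1)"
    unfolding P_def by (rule degree_sum_le) (auto simp: degree_monom_eq intro: power_increasing)
  also have "(2::nat) ^ (n - 1) < 2 ^ n"
    using \<open>n > 0\<close> by (intro power_strict_increasing) auto
  also have "2 ^ n = card (GF2 n :: 'k set)" by (rule card_GF2[OF char2 \<open>n > 0\<close>, symmetric])
  finally have "degree P < card (GF2 n :: 'k set)" .
  moreover have "P \<noteq> 0"
  proof -
    have "coeff P 1 = (\<Sum>i<n. if i = 0 then 1 else 0)"
      unfolding P_def coeff_sum by (intro sum.cong) auto
    then show ?thesis using \<open>n > 0\<close> by auto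
  qed
  ultimately have "\<not> GF2 n \<subseteq> {y. poly P y = 0}"
    using card_poly_roots_bound[of P] poly_roots_finite[of P] card_mono by (metis leD le_trans)
  then obtain y :: 'k where y: "y \<in> GF2 n" "conj_sum n y \<noteq> 0" unfolding poly_P by blast
  have "(of_bit (abs_trace n y) :: 'k) \<noteq> 0" 
    unfolding of_bit_abs_trace[OF char2 y(1)] by (rule y(2))
  then have "abs_trace n y = 1" by (cases "abs_trace n y") simp_all
  then show ?thesis
    using y w by (intro that[of "y * inverse w"]) (simp_all add: GF2_closed mult.assoc)
qed

end

section \<open>The trace form of an additive polynomial\<close>

locale trace_form =
  fixes a :: "nat \<Rightarrow> 'k::alg_closed_field" and d m :: nat
  assumes char2: "CHAR('k) = 2"
    and coeff_mem: "\<And>i. i \<le> d \<Longrightarrow> a i \<in> GF2 m"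
begin

definition lin :: "'k \<Rightarrow> 'k" where
  "lin x = (\<Sum>i\<le>d. a i * x ^ (2 ^ i))"

text \<open>
  The polynomial function \<open>R~\<close>. By \<open>polarisation_form_adj\<close> below, it is, up to a power of the
  Frobenius map, the sum of \<open>lin\<close> and its adjoint for the trace pairing.
\<close>

definition adj :: "'k \<Rightarrow> 'k" where
  "adj x = (\<Sum>i\<le>d. a i ^ (2 ^ d) * x ^ (2 ^ (d + i)) + a i ^ (2 ^ (d - i)) * x ^ (2 ^ (d - i)))"

definition form :: "nat \<Rightarrow> 'k \<Rightarrow> bit" where
  "form n x = abs_trace n (x * lin x)"

lemmas closed = GF2_closed[OF char2] GF2_closed_power[OF char2] GF2_closed_sum[OF char2]

lemma lin_add: "lin (x + y) = lin x + lin y"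
  by (simp add: lin_def char2_add_power[OF char2] distrib_left sum.distrib)

context
  fixes n assumes m_dvd: "m dvd n"
begin

lemma coeff_mem_ext: "i \<le> d \<Longrightarrow> a i \<in> GF2 n"
  using coeff_mem GF2_mono[OF m_dvd] by blast

lemma lin_mem: "x \<in> GF2 n \<Longrightarrow> lin x \<in> GF2 n"
  unfolding lin_def by (intro closed coeff_mem_ext) auto

lemma adj_mem: "x \<in> GF2 n \<Longrightarrow> adj x \<in> GF2 n"
  unfolding adj_def by (intro closed coeff_mem_ext) auto

lemma polarisation_form:
  assumes "x \<in> GF2 n" "y \<in> GF2 n"
  shows "polarisation (form n) x y = abs_trace n (x * lin y + y * lin x)"
proof -
  have "(x + y) * lin (x + y) = (x * lin x + y * lin y) + (x * lin y + y * lin x)"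
    by (simp add: lin_add algebra_simps)
  then have "form n (x + y) = form n x + form n y + abs_trace n (x * lin y + y * lin x)"
    unfolding form_def using assms by (simp only: abs_trace_add[OF char2] closed lin_mem)
  then show ?thesis
    by (cases "form n x"; cases "form n y") (simp_all add: polarisation_def flip: add.assoc)
qed

text \<open>
  The trace is invariant under the Frobenius map. Raising the summand with index \<open>i\<close> of \<open>x * lin y\<close> to
  the power \<open>2 ^ (d - i)\<close>, and each summand of \<open>y * lin x\<close> to the power \<open>2 ^ d\<close>, turns the power of \<open>y\<close>
  into \<open>y ^ (2 ^ d)\<close> in all of them.
\<close>

lemma polarisation_form_adj:
  assumes x: "x \<in> GF2 n" and y: "y \<in> GF2 n"
  shows "polarisation (form n) x y = abs_trace n (y ^ (2 ^ d) * adj x)"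
proof -
  let ?T = "conj_sum n :: 'k \<Rightarrow> 'k"
  have pw: "(z ^ (2 ^ i)) ^ (2 ^ j) = z ^ (2 ^ (i + j))" for z :: 'k and i j
    by (simp only: power_add power_mult)
  have 1: "?T (x * (a i * y ^ (2 ^ i))) = ?T (y ^ (2 ^ d) * (a i ^ (2 ^ (d - i)) * x ^ (2 ^ (d - i))))"
    if i: "i \<le> d" for i
  proof -
    have "?T (x * (a i * y ^ (2 ^ i))) = ?T ((x * (a i * y ^ (2 ^ i))) ^ (2 ^ (d - i)))"
      by (rule conj_sum_frobenius[symmetric]) (intro closed x y coeff_mem_ext i)
    also have "(x * (a i * y ^ (2 ^ i))) ^ (2 ^ (d - i)) =
        y ^ (2 ^ d) * (a i ^ (2 ^ (d - i)) * x ^ (2 ^ (d - i)))"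
      using i by (simp add: power_mult_distrib pw mult.commute mult.left_commute)
    finally show ?thesis .
  qed
  have 2: "?T (y * (a i * x ^ (2 ^ i))) = ?T (y ^ (2 ^ d) * (a i ^ (2 ^ d) * x ^ (2 ^ (d + i))))"
    if i: "i \<le> d" for i
  proof -
    have "?T (y * (a i * x ^ (2 ^ i))) = ?T ((y * (a i * x ^ (2 ^ i))) ^ (2 ^ d))"
      by (rule conj_sum_frobenius[symmetric]) (intro closed x y coeff_mem_ext i)
    also have "(y * (a i * x ^ (2 ^ i))) ^ (2 ^ d) = y ^ (2 ^ d) * (a i ^ (2 ^ d) * x ^ (2 ^ (d + i)))"
      by (simp add: power_mult_distrib pw add.commute)
    finally show ?thesis .
  qed
  have "?T (x * lin y + y * lin x) = ?T (y ^ (2 ^ d) * adj x)"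
    unfolding lin_def adj_def sum_distrib_left distrib_left
      conj_sum_add[OF char2] conj_sum_sum[OF char2] sum.distrib
    by (simp add: 1 2 add.commute)
  then show ?thesis
    unfolding polarisation_form[OF x y] by (rule abs_trace_cong_conj_sum)
qed

lemma F2_quadratic_form_form:
  assumes "n > 0"
  shows "F2_quadratic_form (GF2 n) (form n)"
proof -
  interpret F2_subspace "GF2 n :: 'k set" using assms by (rule F2_subspace_GF2[OF char2])
  show ?thesis
  proof
    fix x y z :: 'k assume xyz: "x \<in> GF2 n" "y \<in> GF2 n" "z \<in> GF2 n"
    have "(x + y) * lin z + z * lin (x + y) = (x * lin z + z * lin x) + (y * lin z + z * lin y)"
      by (simp add: lin_add algebra_simps)
    then show "polarisation (form n) (x + y) z =
        polarisation (form n) x z + polarisation (form n) y z"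
      using xyz by (simp only: polarisation_form closed lin_mem abs_trace_add[OF char2])
  qed
qed

text \<open>
  The map \<open>y \<mapsto> y ^ (2 ^ d)\<close> is a bijection of \<open>GF2 n\<close> and the trace pairing is non-degenerate. So the
  radical depends on \<open>n\<close> only through the condition of lying in \<open>GF2 n\<close>.
\<close>

lemma radical_form:
  assumes "n > 0"
  shows "radical (GF2 n) (form n) = {x \<in> GF2 n. adj x = 0}"
proof (intro equalityI subsetI)
  fix x assume "x \<in> {x \<in> GF2 n. adj x = 0}"
  moreover have "abs_trace n (0::'k) = 0"
    using abs_trace_add[OF char2, of 0 n 0] closed(4) by simp
  ultimately show "x \<in> radical (GF2 n) (form n)"
    by (auto simp: radical_def polarisation_form_adj)
next
  fix x assume "x \<in> radical (GF2 n) (form n)"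
  then have x: "x \<in> GF2 n" and rad: "\<And>y. y \<in> GF2 n \<Longrightarrow> abs_trace n (y ^ (2 ^ d) * adj x) = 0"
    by (auto simp: radical_def polarisation_form_adj)
  have "adj x = 0"
  proof (rule ccontr)
    assume "adj x \<noteq> 0"
    then obtain z where z: "z \<in> GF2 n" "abs_trace n (z * adj x) = 1"
      using abs_trace_nondegenerate[OF char2 assms adj_mem[OF x]] by blast
    \<comment> \<open>A \<open>2 ^ d\<close>-th root of \<open>z\<close>, as \<open>z ^ (2 ^ (n * d)) = z\<close>.\<close>
    have "(z ^ (2 ^ (n * d - d))) ^ (2 ^ d) = z ^ (2 ^ (n * d))"
      using assms by (simp add: power_mult[symmetric] power_add[symmetric])
    also have "\<dots> = z" by (rule GF2_power[OF z(1)])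
    finally show False using rad[of "z ^ (2 ^ (n * d - d))"] z by (simp add: closed)
  qed
  then show "x \<in> {x \<in> GF2 n. adj x = 0}" using x by simp
qed

lemma form_frobenius:
  assumes "x \<in> GF2 (n * k)"
  shows "form (n * k) (x ^ (2 ^ n)) = form (n * k) x"
proof -
  have "lin (x ^ (2 ^ n)) = (\<Sum>i\<le>d. (a i * x ^ (2 ^ i)) ^ (2 ^ n))"
    unfolding lin_def
  proof (rule sum.cong)
    fix i assume "i \<in> {..d}"
    then have "a i ^ (2 ^ n) = a i" using coeff_mem_ext by (simp add: GF2_def)
    then show "a i * (x ^ (2 ^ n)) ^ (2 ^ i) = (a i * x ^ (2 ^ i)) ^ (2 ^ n)"
      by (simp add: power_mult_distrib power_mult[symmetric] mult.commute)
  qed simp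
  then have "x ^ (2 ^ n) * lin (x ^ (2 ^ n)) = (x * lin x) ^ (2 ^ n)"
    by (simp add: lin_def char2_sum_power[OF char2] power_mult_distrib)
  moreover have "x * lin x \<in> GF2 (n * k)"
    unfolding lin_def using coeff_mem_ext GF2_mono[of n "n * k"]
    by (intro closed assms) auto
  ultimately show ?thesis
    unfolding form_def by (metis abs_trace_cong_conj_sum conj_sum_frobenius)
qed

lemma form_restrict:
  assumes "x \<in> GF2 n" "odd k"
  shows "form (n * k) x = form n x"
  unfolding form_def using assms by (intro abs_trace_mult_odd[OF char2] closed lin_mem)

text \<open>
  The map \<open>x \<mapsto> x ^ (2 ^ n)\<close> generates the Galois group of order \<open>p\<close> of the field with \<open>2 ^ (n * p)\<close>
  elements over the field with \<open>2 ^ n\<close> elements. The form is invariant under it, because the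
  coefficients lie in the smaller field, on which the two forms agree because \<open>p\<close> is odd.
\<close>

lemma exp_sum_form_cong:
  assumes "n > 0" and p: "prime p" "odd p"
  shows "[exp_sum (GF2 (n * p)) (form (n * p)) = exp_sum (GF2 n) (form n)] (mod int p)"
proof -
  let ?V = "GF2 (n * p) :: 'k set" and ?g = "\<lambda>x. bit_sign (form (n * p) x)"
    and ?s = "\<lambda>x :: 'k. x ^ (2 ^ n)"
  have iter: "(?s ^^ i) x = x ^ (2 ^ (n * i))" for i x
    by (induction i) (simp_all add: power_mult[symmetric] power_add mult.commute)
  have "[sum ?g ?V = sum ?g {x \<in> ?V. ?s x = x}] (mod int p)"
  proof (rule sum_cong_sum_fixed_points[OF p(1)])
    show "finite ?V" using assms prime_gt_0_nat by (intro finite_GF2[OF char2]) auto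
  qed (simp_all add: closed iter form_frobenius, simp add: GF2_def)
  also have "{x \<in> ?V. ?s x = x} = GF2 n"
    using GF2_mono[of n "n * p"] by (auto simp: GF2_def)
  also have "sum ?g (GF2 n) = exp_sum (GF2 n) (form n)"
    unfolding exp_sum_def by (rule sum.cong) (simp_all add: form_restrict p)
  finally show ?thesis by (simp add: exp_sum_def)
qed

end

text \<open>
  By hypothesis both forms have the same radical, on which they agree. So their exponential sums
  \<open>S\<close> and \<open>S'\<close> satisfy \<open>S'\<^sup>2 = (2 ^ (n * h) * S)\<^sup>2\<close> with \<open>h = (p - 1) div 2\<close>, and only the sign \<open>t\<close> in
  \<open>S' = t * (2 ^ (n * h) * S)\<close> is unknown. Modulo \<open>p\<close> the sums are equal and \<open>2 ^ h\<close> is \<open>chi8 p\<close>, which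
  does not change when it is raised to the odd power \<open>n\<close>. This determines \<open>t\<close>, because \<open>S\<close> is zero or
  prime to \<open>p\<close>.
\<close>

lemma sgn_exp_sum_form_mult_prime:
  assumes n: "m dvd n" "n > 0" "odd n" and p: "prime p" "odd p"
    and roots: "\<And>x. x \<in> GF2 (n * p) \<Longrightarrow> adj x = 0 \<Longrightarrow> x \<in> GF2 n"
  shows "sgn (exp_sum (GF2 (n * p)) (form (n * p))) = chi8 p * sgn (exp_sum (GF2 n) (form n))"
proof -
  define S S' h W where "S = exp_sum (GF2 n) (form n)"
    and "S' = exp_sum (GF2 (n * p)) (form (n * p))"
    and "h = (p - 1) div 2" and "W = {x \<in> GF2 n. adj x = 0}"
  have p0: "p > 0" "p = 2 * h + 1" using p by (auto simp: h_def prime_gt_0_nat)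
  have np: "m dvd n * p" "n * p > 0" using n p0 by auto
  interpret Q: F2_quadratic_form "GF2 n" "form n" by (rule F2_quadratic_form_form[OF n(1,2)])
  interpret Q': F2_quadratic_form "GF2 (n * p)" "form (n * p)"
    by (rule F2_quadratic_form_form[OF np])
  have rad: "radical (GF2 n) (form n) = W"
    by (simp add: W_def radical_form n)
  have "radical (GF2 (n * p)) (form (n * p)) = {x \<in> GF2 (n * p). adj x = 0}"
    by (rule radical_form[OF np])
  also have "\<dots> = W"
    using roots GF2_mono[of n "n * p"] by (auto simp: W_def)
  finally have rad': "radical (GF2 (n * p)) (form (n * p)) = W" .
  have "form (n * p) x = form n x" if "x \<in> W" for x
    using that n(1) p(2) by (intro form_restrict) (auto simp: W_def)
  then have vanish: "(\<forall>x\<in>W. form (n * p) x = 0) \<longleftrightarrow> (\<forall>x\<in>W. form n x = 0)" by simp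
  define T where "T = (if \<forall>x\<in>W. form n x = 0 then int (card W) else 0)"
  have sq: "S\<^sup>2 = 2 ^ n * T" and sq': "S'\<^sup>2 = 2 ^ (n * p) * T"
    unfolding S_def S'_def Q.exp_sum_square Q'.exp_sum_square rad rad' vanish
    using n np by (simp_all add: T_def card_GF2[OF char2])
  have "n * p = n * h * 2 + n" by (simp add: p0(2) algebra_simps)
  then have "S'\<^sup>2 = (2 ^ (n * h) * S)\<^sup>2"
    by (simp only: sq sq' power_mult_distrib power_add power_mult)
  then obtain t :: int where t: "t = 1 \<or> t = -1" "S' = t * (2 ^ (n * h) * S)"
    unfolding power2_eq_iff by (metis mult_1 mult_minus1)
  obtain chi: "chi8 p = 1 \<or> chi8 p = -1" using chi8_odd[OF p(2)] by blast
  show ?thesis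
  proof (cases "S = 0")
    case True
    then show ?thesis using t by (simp flip: S_def S'_def)
  next
    case False
    have "coprime S (int p)"
    proof -
      \<comment> \<open>The square of \<open>S\<close> is a power of \<open>2\<close>, as the radical is a vector space.\<close>
      have "T = int (card W)" using False sq by (auto simp: T_def split: if_splits)
      also have "card W = 2 ^ dim2 W"
        using F2_subspace.card_eq_two_power_dim2[OF Q.F2_subspace_radical] by (simp add: rad)
      finally have "S\<^sup>2 = 2 ^ (n + dim2 W)" by (simp add: sq power_add)
      moreover have "coprime (2 ^ (n + dim2 W)) (int p)" using p(2) by simp
      ultimately show ?thesis by (metis coprime_power_left_iff zero_neq_numeral)
    qed
    have "[(2 ^ h) ^ n = chi8 p ^ n] (mod int p)"
      by (intro cong_pow) (unfold h_def, rule two_power_cong_chi8[OF p])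
    moreover have "chi8 p ^ n = chi8 p" using chi n(3) by auto
    ultimately have "[2 ^ (n * h) = chi8 p] (mod int p)" by (simp add: power_mult mult.commute)
    then have "[t * (2 ^ (n * h) * S) = t * (chi8 p * S)] (mod int p)"
      by (intro cong_mult cong_refl)
    moreover have "[S' = S] (mod int p)"
      unfolding S_def S'_def by (rule exp_sum_form_cong[OF n(1,2) p])
    ultimately have "[(t * chi8 p) * S = 1 * S] (mod int p)"
      unfolding t(2) by (metis cong_sym cong_trans mult.assoc mult_1)
    then have "[t * chi8 p = 1] (mod int p)"
      using \<open>coprime S (int p)\<close> cong_mult_rcancel by blast
    moreover have "p \<ge> 3" using p prime_ge_2_nat[of p] by (cases "p = 2") auto
    ultimately have "t = chi8 p" using t(1) chi by (auto simp: cong_iff_dvd_diff zdvd_not_zless)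
    then show ?thesis by (simp add: t(2) sgn_mult flip: S_def S'_def) (use chi in auto)
  qed
qed

lemma sgn_exp_sum_form_mult:
  assumes g: "m dvd g" "g > 0" "odd (g * k)"
    and roots: "\<And>x. x \<in> GF2 (g * k) \<Longrightarrow> adj x = 0 \<Longrightarrow> x \<in> GF2 g"
  shows "sgn (exp_sum (GF2 (g * k)) (form (g * k))) = chi8 k * sgn (exp_sum (GF2 g) (form g))"
  using g(3) roots
proof (induction k rule: prime_divisors_induct)
  case (factor p k)
  have odd: "odd g" "odd k" "odd p" using factor.prems(1) by auto
  have sub: "GF2 (g * k) \<subseteq> (GF2 (g * (p * k)) :: 'k set)" "GF2 g \<subseteq> (GF2 (g * k) :: 'k set)"
    by (intro GF2_mono; simp)+
  have "x \<in> GF2 g" if "x \<in> GF2 (g * k)" "adj x = 0" for x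
    using that sub(1) factor.prems(2) by blast
  then have IH: "sgn (exp_sum (GF2 (g * k)) (form (g * k))) = chi8 k * sgn (exp_sum (GF2 g) (form g))"
    using odd by (intro factor.IH) auto
  have eq: "g * k * p = g * (p * k)" by simp
  have "sgn (exp_sum (GF2 (g * k * p)) (form (g * k * p))) =
      chi8 p * sgn (exp_sum (GF2 (g * k)) (form (g * k)))"
  proof (rule sgn_exp_sum_form_mult_prime)
    show "x \<in> GF2 (g * k)" if "x \<in> GF2 (g * k * p)" "adj x = 0" for x
      using that sub(2) factor.prems(2) unfolding eq by blast
  qed (use g odd factor.hyps odd_pos[of k] in auto)
  then show ?case unfolding eq IH by (simp add: chi8_mult)
qed (auto simp: chi8_def)

end

section \<open>The invariant of an odd extension\<close>

theorem proposition5p4: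
  fixes a :: "nat \<Rightarrow> 'k::alg_closed_field"
    and R Rt f :: "'k poly"
    and m d N e N' n :: nat
  assumes "CHAR('k) = 2"
    and "m \<ge> 1" and "odd m" and "d \<ge> 1"
    and "\<And>i. i \<le> d \<Longrightarrow> a i \<in> GF2 m"
    and "a d \<noteq> 0"
    and "R = (\<Sum>i\<le>d. monom (a i) (2 ^ i))"
    and "f = [:0, 1:] * R"
    and "Rt = (\<Sum>i\<le>d. monom (a i ^ (2 ^ d)) (2 ^ (d + i))
                     + monom (a i ^ (2 ^ (d - i))) (2 ^ (d - i)))"
    and "splitting_field (GF2 m) Rt = GF2 (m * N)"
    and "N = 2 ^ e * N'" and "odd N'"
    and "n \<ge> 1" and "odd n"
  shows "eps_ext m n f = chi8 (n * gcd n N') * eps_ext m (gcd n N') f"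
proof -
  interpret trace_form a d m by unfold_locales fact+
  have poly_f: "poly f x = x * lin x" for x
    by (simp add: assms lin_def poly_sum poly_monom)
  have poly_Rt: "poly Rt x = adj x" for x
    by (simp add: assms adj_def poly_sum poly_monom)
  have eps: "eps_ext m l f = sgn (exp_sum (GF2 (m * l)) (form (m * l)))" if "l > 0" for l
  proof -
    interpret F2_quadratic_form "GF2 (m * l)" "form (m * l)"
      using that assms(2) by (intro F2_quadratic_form_form) auto
    show ?thesis
      unfolding qf_eps_eq_sgn_exp_sum [symmetric] by (simp add: eps_ext_def poly_f form_def [abs_def])
  qed
  define g where "g = gcd n N'"
  have g: "g > 0" "g dvd n" "odd g"
    using assms(13,14) by (auto simp: g_def)
  then obtain k where k: "n = g * k" by blast
  have gcd_N: "gcd n N = g"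
  proof -
    have "coprime n (2 ^ e)" using assms(14) by (simp add: coprime_commute)
    then show ?thesis
      unfolding g_def assms(11) by (simp add: gcd_mult_right_left_cancel)
  qed
  have roots: "x \<in> GF2 (m * g)" if "x \<in> GF2 (m * g * k)" "adj x = 0" for x
  proof -
    have "x \<in> splitting_field (GF2 m) Rt"
      using that(2) by (auto simp: splitting_field_def poly_Rt)
    then have "x \<in> GF2 (gcd (m * n) (m * N))"
      using that(1) unfolding assms(10) k by (intro GF2_Int) (simp_all add: mult.assoc)
    then show ?thesis by (simp add: gcd_N flip: gcd_mult_distrib_nat)
  qed
  have "sgn (exp_sum (GF2 (m * g * k)) (form (m * g * k))) =
      chi8 k * sgn (exp_sum (GF2 (m * g)) (form (m * g)))"
    using assms(2,3,14) g k by (intro sgn_exp_sum_form_mult roots) auto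
  moreover have "m * g * k = m * n" by (simp add: k)
  ultimately have "eps_ext m n f = chi8 k * eps_ext m g f"
    using eps[of n] eps[of g] assms(13) g(1) by simp
  \<comment> \<open>Here \<open>n * g = g * g * k\<close> with \<open>g\<close> odd.\<close>
  moreover have "chi8 (n * g) = chi8 k"
    using chi8_odd[OF g(3)] by (auto simp: k chi8_mult)
  ultimately show ?thesis by (simp add: g_def)
qed

end
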